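(* Let $I\subseteq[n]$, $\overline{J}\subseteq[\overline{n}]$ be a valid pair and let $G=G(I,\overline{J})$, with partially augmented graph $\widehat{G}$. Then there exist linear maps $\pi_1:\mathbb{R}^{E(\widehat G)}\to\mathbb{R}^{E(G)}$, $\varphi_1:\mathbb{R}^{E(\widehat G)}\to\mathbb{R}^{2n}$, $\pi_2:\mathbb{R}^{2n}\to\mathbb{R}^{n}$ and $\varphi_2:\mathbb{R}^{E(G)}\to\mathbb{R}^{n}$ such that: (i) $\pi_1$ is a projection (the coordinate projection onto the coordinates indexed by $E(G)$) with $\pi_1(\mathcal{F}_{\widehat G})=\mathcal{S}(G)$; (ii) $\pi_2$ is a projection with $\pi_2(\mathcal{U}_{I,\overline J})=\mathcal{P}(G)$; (iii) $\varphi_1$ restricts to an integral equivalence $\mathcal{F}_{\widehat G}\to\mathcal{U}_{I,\overline J}$, and $\varphi_2$ restricts to an integral equivalence $\mathcal{S}(G)\to\mathcal{P}(G)$; (iv) the square commutes: $\pi_2\circ\varphi_1=\varphi_2\circ\pi_1$ on $\mathcal{F}_{\widehat G}$.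
   Context: Fix an integer $n\ge1$. Write $[n]=\{1,\dots,n\}$, $[\overline{n}]=\{\overline1,\dots,\overline n\}$, and totally order $[n]\sqcup[\overline n]$ by $1\prec\overline1\prec2\prec\overline2\prec\cdots\prec n\prec\overline n$. A pair $I\subseteq[n]$, $\overline J\subseteq[\overline n]$ is valid if (w.r.t. $\prec$) $\min(I\sqcup\overline J)\in I$ and $\max(I\sqcup\overline J)\in\overline J$. Define $\mathrm{prec}:\overline J\to[n]$: if, in the order $\prec$ restricted to $I\sqcup\overline J$, the element $\overline j$ is immediately preceded by an element $i\in I$, then $\mathrm{prec}(\overline j)=i$; otherwise $\mathrm{prec}(\overline j)=j$. Let $A(I,\overline J)$ be the directed graph on $I\sqcup\overline J$ with arcs $(i,\overline j)$ for all $i\in I$, $\overline j\in\overline J$ with $i\prec\overline j$. Let $\mathrm{prec}(A(I,\overline J))$ be the simple directed graph on vertex set $I\cup\mathrm{prec}(\overline J)\subseteq[n]$ (the quotient identifying each $\overline j$ with $\mathrm{prec}(\overline j)$) with edges $(i,\mathrm{prec}(\overline j))$ for $i\in I$, $\overline j\in\overline J$, $i<\mathrm{prec}(\overline j)$. For a simple directed graph $H$ on a subset of $[n]$ with all edges directed from smaller to larger vertex, $\min(H)$ is obtained by deleting every edge $(i,j)$ for which $H$ has a directed path $i,i_1,\dots,i_k,j$ with $k\ge1$. Set $G(I,\overline J)=\min(\mathrm{prec}(A(I,\overline J)))$. The partially augmented graph $\widehat G$ of $G=G(I,\overline J)$ has vertex set $V(G)\cup\{s,t\}$ and edge set $E(G)\cup\{(s,i):i\in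 I\}\cup\{(\mathrm{prec}(\overline j),t):\overline j\in\overline J\}$. A route is a directed path from $s$ to $t$ in $\widehat G$. The flow polytope $\mathcal F_{\widehat G}\subseteq\mathbb R^{E(\widehat G)}$ is the set of $x\ge0$ whose net outflow $\sum_{e\text{ out of }v}x_e-\sum_{e\text{ into }v}x_e$ is $1$ at $s$, $-1$ at $t$ and $0$ at all other vertices (equivalently, the convex hull of indicator vectors of routes). $\mathcal U_{I,\overline J}=\mathrm{conv}\{(\mathbf e_i,\mathbf e_{\overline j}): i\in I,\overline j\in\overline J,i\prec\overline j\}\subseteq\mathbb R^n\times\mathbb R^n=\mathbb R^{2n}$, where the second factor has standard basis $\mathbf e_{\overline1},\dots,\mathbf e_{\overline n}$. $\mathcal P(G)=\mathrm{conv}\{\mathbf 0,\mathbf e_i-\mathbf e_j:1\le i<j\le n\}\cap\mathrm{cone}\{\mathbf e_i-\mathbf e_j:(i,j)\in E(G)\}\subseteq\mathbb R^n$ (the acyclic root polytope of $G$). $\mathcal S(G)\subseteq\mathbb R^{E(G)}$ is the convex hull of $\mathbf 0$ and the indicator vectors of all directed paths $(v_1,\dots,v_\ell)$ in $G$ with $v_1\in I$ and $v_\ell\in\mathrm{prec}(\overline J)$. Two lattice polytopes $P\subseteq\mathbb R^a$, $Q\subseteq\mathbb R^b$ are integrally equivalent via an affine map $\varphi$ if $\varphi$ restricts to a bijection $P\to Q$ that is also a bijection between $\mathbb Z^a\cap\mathrm{aff}(P)$ and $\mathbb Z^b\cap\mathrm{aff}(Q)$. *)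

theory Defs
  imports "HOL-Analysis.Analysis" "HOL-Analysis.Finite_Function_Topology"
begin

section \<open>Coordinate spaces\<close>

text \<open>
  \<open>\<real>\<^sup>A\<close> for a finite index set \<open>A\<close> is the subspace of finitely supported functions
  (type \<open>'a \<Rightarrow>\<^sub>0 real\<close>, a real vector space) that vanish off \<open>A\<close>. Every linear map on this
  subspace extends to the whole type, so a linear map \<open>\<real>\<^sup>A \<rightarrow> \<real>\<^sup>B\<close> may be given as a
  \<^const>\<open>linear\<close> function on the type that sends \<open>\<real>\<^sup>A\<close> into \<open>\<real>\<^sup>B\<close>.
  The space \<open>\<real>\<^sup>2\<^sup>n = \<real>\<^sup>n \<times> \<real>\<^sup>n\<close> is a product of two such subspaces.
\<close>

definition rspace :: "'a set \<Rightarrow> ('a \<Rightarrow>\<^sub>0 real) set" where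
  "rspace A = {x. Poly_Mapping.keys x \<subseteq> A}"

definition zspace :: "'a set \<Rightarrow> ('a \<Rightarrow>\<^sub>0 real) set" where
  "zspace A = {x \<in> rspace A. \<forall>a\<in>A. Poly_Mapping.lookup x a \<in> \<int>}"

definition unit_vec :: "'a \<Rightarrow> 'a \<Rightarrow>\<^sub>0 real" where
  "unit_vec a = Poly_Mapping.single a 1"

definition indicator_vec :: "'a set \<Rightarrow> 'a \<Rightarrow>\<^sub>0 real" where
  "indicator_vec X = (\<Sum>a\<in>X. unit_vec a)"

definition linear_map_on ::
    "'a::real_vector set \<Rightarrow> 'b::real_vector set \<Rightarrow> ('a \<Rightarrow> 'b) \<Rightarrow> bool" where
  "linear_map_on V W f \<longleftrightarrow> linear f \<and> f ` V \<subseteq> W"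

definition lattice_polytope :: "'a::real_vector set \<Rightarrow> 'a set \<Rightarrow> bool" where
  "lattice_polytope L P \<longleftrightarrow> (\<exists>S. finite S \<and> S \<subseteq> L \<and> P = convex hull S)"

text \<open>The sets \<open>L\<close> and \<open>M\<close> are the integer lattices of the spaces containing \<open>P\<close> and \<open>Q\<close>.\<close>

definition integral_equivalence ::
    "'a::real_vector set \<Rightarrow> 'a set \<Rightarrow> 'b::real_vector set \<Rightarrow> 'b set \<Rightarrow> ('a \<Rightarrow> 'b) \<Rightarrow> bool" where
  "integral_equivalence L P M Q f \<longleftrightarrow>
     lattice_polytope L P \<and> lattice_polytope M Q \<and>
     bij_betw f P Q \<and> bij_betw f (L \<inter> affine hull P) (M \<inter> affine hull Q)"


section \<open>Directed graphs, given by their edge sets\<close>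

definition dpath :: "('v \<times> 'v) set \<Rightarrow> 'v list \<Rightarrow> bool" where
  "dpath E vs \<longleftrightarrow> vs \<noteq> [] \<and> distinct vs \<and> successively (\<lambda>u v. (u, v) \<in> E) vs"

definition path_edges :: "'v list \<Rightarrow> ('v \<times> 'v) set" where
  "path_edges vs = set (zip vs (tl vs))"

definition min_edges :: "('v \<times> 'v) set \<Rightarrow> ('v \<times> 'v) set" where
  "min_edges E = {(i, j) \<in> E. \<not> (\<exists>vs. vs \<noteq> [] \<and> dpath E (i # vs @ [j]))}"

definition netflow :: "('v \<times> 'v) set \<Rightarrow> ('v \<times> 'v \<Rightarrow>\<^sub>0 real) \<Rightarrow> 'v \<Rightarrow> real" where
  "netflow E x v = (\<Sum>e\<in>{e \<in> E. fst e = v}. Poly_Mapping.lookup x e)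
                 - (\<Sum>e\<in>{e \<in> E. snd e = v}. Poly_Mapping.lookup x e)"

definition flow_polytope ::
    "'v set \<Rightarrow> ('v \<times> 'v) set \<Rightarrow> 'v \<Rightarrow> 'v \<Rightarrow> ('v \<times> 'v \<Rightarrow>\<^sub>0 real) set" where
  "flow_polytope V E s t =
     {x \<in> rspace E. (\<forall>e\<in>E. 0 \<le> Poly_Mapping.lookup x e) \<and>
        (\<forall>v\<in>V. netflow E x v = (if v = s then 1 else if v = t then -1 else 0))}"

definition path_polytope ::
    "('v \<times> 'v) set \<Rightarrow> 'v set \<Rightarrow> 'v set \<Rightarrow> ('v \<times> 'v \<Rightarrow>\<^sub>0 real) set" where
  "path_polytope E A B =
     convex hull (insert 0 {indicator_vec (path_edges vs) | vs.
                              dpath E vs \<and> hd vs \<in> A \<and> last vs \<in> B})"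

definition root_polytope :: "nat \<Rightarrow> (nat \<times> nat) set \<Rightarrow> (nat \<Rightarrow>\<^sub>0 real) set" where
  "root_polytope n E =
     convex hull (insert 0 {unit_vec i - unit_vec j | i j. 1 \<le> i \<and> i < j \<and> j \<le> n})
     \<inter> convex_cone hull {unit_vec i - unit_vec j | i j. (i, j) \<in> E}"


section \<open>The graph of a valid pair\<close>

text \<open>
  The disjoint union of \<open>[n]\<close> and its barred copy, ordered by
  \<open>1 \<prec> \<bar>1 \<prec> 2 \<prec> \<bar>2 \<prec> \<dots>\<close>; \<open>Plain i\<close> is \<open>i\<close> and \<open>Barred j\<close> is \<open>j\<close> with a bar.
  A set of barred elements is represented by the set \<open>J\<close> of the underlying numbers.
\<close>

datatype elt = Plain nat | Barred nat

fun rank :: "elt \<Rightarrow> nat" where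
  "rank (Plain i) = 2 * i"
| "rank (Barred j) = 2 * j + 1"

lemma rank_inject: "rank x = rank y \<longleftrightarrow> x = y"
  by (cases x; cases y) (auto, presburger+)

instantiation elt :: linorder
begin

definition less_eq_elt :: "elt \<Rightarrow> elt \<Rightarrow> bool" where
  "x \<le> y \<longleftrightarrow> rank x \<le> rank y"

definition less_elt :: "elt \<Rightarrow> elt \<Rightarrow> bool" where
  "x < y \<longleftrightarrow> rank x < rank y"

instance
  by standard (auto simp: less_eq_elt_def less_elt_def rank_inject)

end

definition support :: "nat set \<Rightarrow> nat set \<Rightarrow> elt set" where
  "support I J = Plain ` I \<union> Barred ` J"

definition valid_pair :: "nat set \<Rightarrow> nat set \<Rightarrow> bool" where
  "valid_pair I J \<longleftrightarrow>
     Min (support I J) \<in> Plain ` I \<and> Max (support I J) \<in> Barred ` J"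

definition immediately_precedes :: "elt set \<Rightarrow> elt \<Rightarrow> elt \<Rightarrow> bool" where
  "immediately_precedes X x y \<longleftrightarrow>
     x \<in> X \<and> y \<in> X \<and> x < y \<and> \<not> (\<exists>z\<in>X. x < z \<and> z < y)"

definition prec :: "nat set \<Rightarrow> nat set \<Rightarrow> nat \<Rightarrow> nat" where
  "prec I J j =
     (if \<exists>i\<in>I. immediately_precedes (support I J) (Plain i) (Barred j)
      then THE i. i \<in> I \<and> immediately_precedes (support I J) (Plain i) (Barred j)
      else j)"

definition prec_edges :: "nat set \<Rightarrow> nat set \<Rightarrow> (nat \<times> nat) set" where
  "prec_edges I J = {(i, prec I J j) | i j. i \<in> I \<and> j \<in> J \<and> i < prec I J j}"

definition G_verts :: "nat set \<Rightarrow> nat set \<Rightarrow> nat set" where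
  "G_verts I J = I \<union> prec I J ` J"

definition G_edges :: "nat set \<Rightarrow> nat set \<Rightarrow> (nat \<times> nat) set" where
  "G_edges I J = min_edges (prec_edges I J)"

datatype aug_vert = Source | Sink | Inner nat

definition Ghat_verts :: "nat set \<Rightarrow> nat set \<Rightarrow> aug_vert set" where
  "Ghat_verts I J = Inner ` G_verts I J \<union> {Source, Sink}"

definition Ghat_edges :: "nat set \<Rightarrow> nat set \<Rightarrow> (aug_vert \<times> aug_vert) set" where
  "Ghat_edges I J =
     {(Inner i, Inner j) | i j. (i, j) \<in> G_edges I J}
     \<union> {(Source, Inner i) | i. i \<in> I}
     \<union> {(Inner (prec I J j), Sink) | j. j \<in> J}"


section \<open>The four polytopes\<close>

definition F_Ghat :: "nat set \<Rightarrow> nat set \<Rightarrow> (aug_vert \<times> aug_vert \<Rightarrow>\<^sub>0 real) set" where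
  "F_Ghat I J = flow_polytope (Ghat_verts I J) (Ghat_edges I J) Source Sink"

definition U_poly :: "nat set \<Rightarrow> nat set \<Rightarrow> ((nat \<Rightarrow>\<^sub>0 real) \<times> (nat \<Rightarrow>\<^sub>0 real)) set" where
  "U_poly I J =
     convex hull {(unit_vec i, unit_vec j) | i j. i \<in> I \<and> j \<in> J \<and> Plain i < Barred j}"

definition P_G :: "nat \<Rightarrow> nat set \<Rightarrow> nat set \<Rightarrow> (nat \<Rightarrow>\<^sub>0 real) set" where
  "P_G n I J = root_polytope n (G_edges I J)"

definition S_G :: "nat set \<Rightarrow> nat set \<Rightarrow> (nat \<times> nat \<Rightarrow>\<^sub>0 real) set" where
  "S_G I J = path_polytope (G_edges I J) I (prec I J ` J)"

end

theory Submission
  imports Defs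
begin

text \<open>
  Put \<open>K = prec(J)\<close>. Since \<open>prec\<close> is injective and \<open>i \<prec> \<bar>j\<close> iff \<open>i \<le> prec(j)\<close>, everything can be
  expressed by \<open>I\<close> and \<open>K\<close>: the edges of \<open>G\<close> are the pairs \<open>i < k\<close> in \<open>I \<times> K\<close> without an element of
  \<open>I \<inter> K\<close> strictly between. Between any \<open>i \<le> k\<close> in \<open>I \<times> K\<close> there is (weakly) an element of
  \<open>I \<inter> K\<close>, which makes \<open>G\<close> a forest. Hence a flow is determined, over the integers, by its values
  on the source and sink edges, and a flow on \<open>G\<close> by its net flow. The map \<open>\<phi>\<^sub>1\<close> records the
  source and sink values, and sends routes to the vertices of \<open>\<U>\<close>. The source values of a
  flow stochastically dominate its sink values, because edges go up; coupling the two
  distributions shows that \<open>\<phi>\<^sub>1\<close> maps the flow polytope into \<open>\<U>\<close>, and by injectivity the flow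
  polytope is the convex hull of the routes. The map \<open>\<phi>\<^sub>2\<close> takes net flows.
\<close>

section \<open>Linear maps on coordinate spaces\<close>

lemma lookup_scaleR [simp]:
  "Poly_Mapping.lookup (r *\<^sub>R x) a = r * Poly_Mapping.lookup x a" for x :: "'a \<Rightarrow>\<^sub>0 real"
  by (simp add: scaleR_poly_mapping_def)

lemma lookup_unit_vec: "Poly_Mapping.lookup (unit_vec a) b = of_bool (a = b)"
  by (simp add: unit_vec_def lookup_single when_def)

lemma lookup_indicator_vec:
  "finite X \<Longrightarrow> Poly_Mapping.lookup (indicator_vec X) a = of_bool (a \<in> X)"
  by (simp add: indicator_vec_def lookup_sum lookup_unit_vec of_bool_def sum.delta)

lemma rspace_iff: "x \<in> rspace A \<longleftrightarrow> (\<forall>a. a \<notin> A \<longrightarrow> Poly_Mapping.lookup x a = 0)"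
  by (auto simp: rspace_def in_keys_iff)

lemma unit_vec_in_rspace: "a \<in> A \<Longrightarrow> unit_vec a \<in> rspace A"
  by (auto simp: rspace_iff lookup_unit_vec)

lemma subspace_rspace: "subspace (rspace A)"
  by (auto simp: subspace_def rspace_iff lookup_add)

lemma rspace_eqI:
  assumes "x \<in> rspace A" "y \<in> rspace A"
    and "\<And>a. a \<in> A \<Longrightarrow> Poly_Mapping.lookup x a = Poly_Mapping.lookup y a"
  shows "x = y"
  using assms by (intro poly_mapping_eqI) (metis rspace_iff)

lemma linear_lookup_sum:
  "linear (\<lambda>x :: 'a \<Rightarrow>\<^sub>0 real. \<Sum>b\<in>B. Poly_Mapping.lookup x (f b) *\<^sub>R w b)"
  by (rule linearI)
    (simp_all add: lookup_add scaleR_add_left sum.distrib scaleR_sum_right)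

lemma lookup_sum_unit_vec:
  assumes "finite B" "inj_on g B"
  shows "b \<in> B \<Longrightarrow> Poly_Mapping.lookup (\<Sum>b\<in>B. c b *\<^sub>R unit_vec (g b)) (g b) = c b"
    and "a \<notin> g ` B \<Longrightarrow> Poly_Mapping.lookup (\<Sum>b\<in>B. c b *\<^sub>R unit_vec (g b)) a = 0"
proof -
  assume b: "b \<in> B"
  have "(\<Sum>b'\<in>B. c b' * of_bool (g b' = g b)) = (\<Sum>b'\<in>B. if b' = b then c b' else 0)"
    using assms(2) b by (intro sum.cong) (auto dest: inj_onD)
  then show "Poly_Mapping.lookup (\<Sum>b\<in>B. c b *\<^sub>R unit_vec (g b)) (g b) = c b"
    using b assms(1) by (simp add: lookup_sum lookup_unit_vec)
next
  assume "a \<notin> g ` B"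
  then show "Poly_Mapping.lookup (\<Sum>b\<in>B. c b *\<^sub>R unit_vec (g b)) a = 0"
    by (auto simp: lookup_sum lookup_unit_vec intro!: sum.neutral)
qed

lemma zspace_iff: "x \<in> zspace A \<longleftrightarrow> x \<in> rspace A \<and> (\<forall>a. Poly_Mapping.lookup x a \<in> \<int>)"
  by (auto simp: zspace_def rspace_iff)

lemma rspace_prescribed:
  assumes "finite A"
  obtains x where "x \<in> rspace A" "\<And>a. a \<in> A \<Longrightarrow> Poly_Mapping.lookup x a = f a"
proof
  show "(\<Sum>a\<in>A. f a *\<^sub>R unit_vec a) \<in> rspace A"
    using lookup_sum_unit_vec(2)[OF assms, of "\<lambda>a. a"] by (simp add: rspace_iff)
  show "Poly_Mapping.lookup (\<Sum>a\<in>A. f a *\<^sub>R unit_vec a) a = f a" if "a \<in> A" for a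
    using lookup_sum_unit_vec(1)[OF assms, of "\<lambda>a. a"] that by simp
qed

lemma sum_of_bool_scaleR:
  fixes f :: "'a \<Rightarrow> 'b::real_vector"
  assumes "finite A" "a \<in> A"
  shows "(\<Sum>x\<in>A. of_bool (x = a) *\<^sub>R f x) = f a"
proof -
  have "(\<Sum>x\<in>A. of_bool (x = a) *\<^sub>R f x) = (\<Sum>x\<in>A. if x = a then f x else 0)"
    by (intro sum.cong) auto
  then show ?thesis using assms by simp
qed

section \<open>Affine hulls, lattice polytopes and integral equivalence under linear maps\<close>

lemma affine_hull_linear_image_eq:
  assumes "linear f"
  shows "affine hull (f ` S) = f ` (affine hull S)"
proof
  have 1: "affine (f ` T)" if "affine T" for T
    using that unfolding affine_def
    by (force simp: linear_add[OF assms, symmetric] linear_scale[OF assms, symmetric])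
  have 2: "affine {x. f x \<in> T}" if "affine T" for T
    using that unfolding affine_def
    by (simp add: linear_add[OF assms] linear_scale[OF assms])
  show "affine hull (f ` S) \<subseteq> f ` (affine hull S)"
    by (intro hull_minimal image_mono hull_subset 1 affine_affine_hull)
  have "affine hull S \<subseteq> {x. f x \<in> affine hull (f ` S)}"
    by (intro hull_minimal 2 affine_affine_hull) (auto intro: hull_inc)
  then show "f ` (affine hull S) \<subseteq> affine hull (f ` S)"
    by blast
qed

lemma lattice_polytope_linear_image:
  assumes "linear f" "f ` L \<subseteq> M" "lattice_polytope L P"
  shows "lattice_polytope M (f ` P)"
proof -
  obtain S where S: "finite S" "S \<subseteq> L" "P = convex hull S"
    using assms(3) by (auto simp: lattice_polytope_def)
  then have "f ` P = convex hull (f ` S)"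
    using assms(1) by (simp add: convex_hull_linear_image)
  with S assms(2) show ?thesis
    unfolding lattice_polytope_def by (intro exI[of _ "f ` S"]) auto
qed

text \<open>A linear map carries the affine hull of \<open>P\<close> onto that of its image, so
  every lattice point there has a preimage in the hull. The last hypothesis makes that preimage a
  lattice point, which is the surjectivity on lattices.\<close>

lemma integral_equivalence_linearI:
  assumes "linear f" "lattice_polytope L P" "lattice_polytope M (f ` P)"
    and "inj_on f (affine hull P)" "f ` L \<subseteq> M"
    and "\<And>x. x \<in> affine hull P \<Longrightarrow> f x \<in> M \<Longrightarrow> x \<in> L"
  shows "integral_equivalence L P M (f ` P) f"
proof -
  have "bij_betw f P (f ` P)"
    using assms(4) hull_subset inj_on_subset by (metis inj_on_imp_bij_betw)
  moreover have "f ` (L \<inter> affine hull P) = M \<inter> affine hull (f ` P)"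
    using assms(5,6) by (auto simp: affine_hull_linear_image_eq[OF assms(1)])
  then have "bij_betw f (L \<inter> affine hull P) (M \<inter> affine hull (f ` P))"
    using assms(4) by (auto simp: bij_betw_def intro: inj_on_subset)
  ultimately show ?thesis
    using assms(2,3) by (simp add: integral_equivalence_def)
qed

section \<open>Flows and paths\<close>

lemma netflow_eq_sum:
  assumes "finite E"
  shows "netflow E x v =
    (\<Sum>e\<in>E. Poly_Mapping.lookup x e * (of_bool (fst e = v) - of_bool (snd e = v)))"
proof -
  have "(\<Sum>e\<in>{e \<in> E. h e = v}. Poly_Mapping.lookup x e) =
      (\<Sum>e\<in>E. Poly_Mapping.lookup x e * of_bool (h e = v))" for h :: "_ \<Rightarrow> 'a"
    using assms by (simp add: sum.inter_filter of_bool_def if_distrib cong: if_cong)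
  then show ?thesis
    by (simp add: netflow_def right_diff_distrib sum_subtractf)
qed

text \<open>After exchanging the sums, an edge with both ends in \<open>S\<close> cancels. Only
  edges across the boundary of \<open>S\<close> remain, which is used for cuts and for the total net
  flow.\<close>

lemma sum_netflow:
  assumes "finite E" "finite S"
  shows "(\<Sum>v\<in>S. netflow E c v) =
    (\<Sum>e\<in>E. Poly_Mapping.lookup c e * (of_bool (fst e \<in> S) - of_bool (snd e \<in> S)))"
proof -
  have delta: "(\<Sum>v\<in>S. of_bool (u = v) :: real) = of_bool (u \<in> S)" for u
    using assms(2) by (simp add: of_bool_def)
  have "(\<Sum>v\<in>S. netflow E c v) =
      (\<Sum>e\<in>E. \<Sum>v\<in>S. Poly_Mapping.lookup c e * (of_bool (fst e = v) - of_bool (snd e = v)))"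
    unfolding netflow_eq_sum[OF assms(1)] by (rule sum.swap)
  also have "\<dots> = (\<Sum>e\<in>E. Poly_Mapping.lookup c e * (of_bool (fst e \<in> S) - of_bool (snd e \<in> S)))"
    by (simp only: sum_distrib_left[symmetric] sum_subtractf delta)
  finally show ?thesis .
qed

lemma path_edges_simps [simp]:
  "path_edges [] = {}" "path_edges [u] = {}"
  "path_edges (u # v # vs) = insert (u, v) (path_edges (v # vs))"
  by (simp_all add: path_edges_def)

lemma finite_path_edges [simp]: "finite (path_edges vs)"
  by (simp add: path_edges_def)

lemma path_edges_subset: "path_edges vs \<subseteq> set vs \<times> set vs"
  by (auto simp: path_edges_def dest: set_zip_leftD set_zip_rightD list.set_sel(2)[rotated])
    (metis empty_iff list.sel(2) list.set(1) list.set_sel(2) set_zip_rightD)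

lemma dpath_path_edges: "dpath E vs \<Longrightarrow> path_edges vs \<subseteq> E"
proof (induction vs rule: induct_list012)
  case (3 u v vs)
  then show ?case by (auto simp: dpath_def)
qed auto

lemma netflow_path:
  assumes "finite E" "dpath E vs"
  shows "netflow E (indicator_vec (path_edges vs)) v = of_bool (v = hd vs) - of_bool (v = last vs)"
  using assms(2)
proof (induction vs rule: induct_list012)
  case 1
  then show ?case by (simp add: dpath_def)
next
  case (2 u)
  then show ?case using assms(1) by (simp add: netflow_eq_sum indicator_vec_def)
next
  case (3 u w vs)
  then have IH: "netflow E (indicator_vec (path_edges (w # vs))) v =
      of_bool (v = w) - of_bool (v = last (w # vs))" and uw: "(u, w) \<in> E"
    by (auto simp: dpath_def)
  \<comment> \<open>Distinctness of the vertices keeps the first edge from occurring again, so the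
    indicator vector splits and the end terms at \<open>w\<close> telescope.\<close>
  have "(u, w) \<notin> path_edges (w # vs)"
    using 3 path_edges_subset[of "w # vs"] by (auto simp: dpath_def)
  then have "indicator_vec (path_edges (u # w # vs)) =
      unit_vec (u, w) + indicator_vec (path_edges (w # vs))"
    by (simp add: indicator_vec_def)
  moreover have "netflow E (unit_vec (u, w)) v = of_bool (u = v) - of_bool (w = v)"
  proof -
    have "netflow E (unit_vec (u, w)) v =
        (\<Sum>e\<in>E. if e = (u, w) then of_bool (fst e = v) - of_bool (snd e = v) else 0)"
      unfolding netflow_eq_sum[OF assms(1)]
      by (intro sum.cong) (auto simp: lookup_unit_vec)
    then show ?thesis
      using assms(1) uw by simp
  qed
  ultimately show ?case
    using IH assms(1) by (auto simp: netflow_eq_sum lookup_add distrib_right sum.distrib)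
qed

lemma path_edges_augmented:
  assumes "vs \<noteq> []"
  shows "path_edges (Source # map Inner vs @ [Sink]) =
    insert (Source, Inner (hd vs)) (insert (Inner (last vs), Sink)
      ((\<lambda>e. (Inner (fst e), Inner (snd e))) ` path_edges vs))"
proof -
  have "path_edges (map Inner vs @ [Sink]) =
      insert (Inner (last vs), Sink) ((\<lambda>e. (Inner (fst e), Inner (snd e))) ` path_edges vs)"
    using assms by (induction vs rule: induct_list012) (auto simp: insert_commute)
  then show ?thesis
    using assms by (cases vs) auto
qed

section \<open>Finite sums and couplings\<close>

lemma sum_max_zero:
  fixes f :: "'a \<Rightarrow> real"
  assumes "finite B" "A \<subseteq> B" "\<And>b. b \<in> B - A \<Longrightarrow> f b \<le> 0"
  shows "(\<Sum>a\<in>A. max 0 (f a)) = (\<Sum>b\<in>B. max 0 (f b))"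
  using assms by (intro sum.mono_neutral_left) (auto simp: max_def intro: antisym)

lemma sum_decrease_at:
  fixes p :: "'a \<Rightarrow> real"
  assumes "finite A"
  shows "sum (p(a := p a - e)) A = sum p A - (if a \<in> A then e else 0)"
proof -
  have "sum (p(a := p a - e)) A = (\<Sum>x\<in>A. p x - (if x = a then e else 0))"
    by (intro sum.cong) auto
  then show ?thesis
    using assms by (simp add: sum_subtractf)
qed

text \<open>Greedy transport: the smallest \<open>k0\<close> with nonzero \<open>q\<close> is served
  from some \<open>i0 \<le> k0\<close> with nonzero \<open>p\<close>, which dominance at
  \<open>t = k0\<close> provides. Each move empties one of the two points, so the number of nonzero
  values drops.\<close>

lemma coupling_of_dominance:
  fixes p q :: "nat \<Rightarrow> real"
  assumes "finite I" "finite K"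
    and "\<And>i. i \<in> I \<Longrightarrow> 0 \<le> p i" "\<And>k. k \<in> K \<Longrightarrow> 0 \<le> q k"
    and "sum p I = sum q K"
    and "\<And>t. sum q {k \<in> K. k \<le> t} \<le> sum p {i \<in> I. i \<le> t}"
  shows "\<exists>c. (\<forall>i k. 0 \<le> c i k) \<and> (\<forall>i\<in>I. \<forall>k\<in>K. c i k \<noteq> 0 \<longrightarrow> i \<le> k) \<and>
    (\<forall>i\<in>I. (\<Sum>k\<in>K. c i k) = p i) \<and> (\<forall>k\<in>K. (\<Sum>i\<in>I. c i k) = q k)"
  using assms(3-)
proof (induction "card {i \<in> I. p i \<noteq> 0} + card {k \<in> K. q k \<noteq> 0}" arbitrary: p q
    rule: less_induct)
  case less
  show ?case
  proof (cases "\<forall>k\<in>K. q k = 0")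
    case True
    then have "sum p I = 0"
      using less.prems(3) by simp
    then have "\<forall>i\<in>I. p i = 0"
      using less.prems(1) assms(1) by (simp add: sum_nonneg_eq_0_iff)
    with True show ?thesis
      by (intro exI[of _ "\<lambda>i k. 0"]) auto
  next
    case False
    define k0 where "k0 = Min {k \<in> K. q k \<noteq> 0}"
    have "k0 \<in> {k \<in> K. q k \<noteq> 0}"
      unfolding k0_def using False assms(2) by (intro Min_in) auto
    then have k0: "k0 \<in> K" "q k0 > 0"
      using less.prems(2)[of k0] by auto
    have k0_min: "q k = 0" if "k \<in> K" "k < k0" for k
    proof (rule ccontr)
      assume "q k \<noteq> 0"
      then have "k0 \<le> k"
        unfolding k0_def using that assms(2) by (intro Min_le) auto
      with that show False by simp
    qed
    have "0 < q k0" by (fact k0)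
    also have "\<dots> \<le> sum q {k \<in> K. k \<le> k0}"
      using k0 less.prems(2) assms(2) by (intro member_le_sum) auto
    also have "\<dots> \<le> sum p {i \<in> I. i \<le> k0}"
      by (fact less.prems(4))
    finally obtain i0 where i0: "i0 \<in> I" "i0 \<le> k0" "p i0 \<noteq> 0"
      by (metis (no_types, lifting) less_irrefl mem_Collect_eq sum.neutral)
    then have pi0: "p i0 > 0"
      using less.prems(1)[of i0] by auto
    \<comment> \<open>The largest amount that can be moved from \<open>i0\<close> to
      \<open>k0\<close>.\<close>
    define e where "e = min (p i0) (q k0)"
    have e: "e > 0" "e \<le> p i0" "e \<le> q k0" "e = p i0 \<or> e = q k0"
      using pi0 k0 by (auto simp: e_def)
    define p' q' where "p' = p(i0 := p i0 - e)" and "q' = q(k0 := q k0 - e)"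
    have sub: "{i \<in> I. p' i \<noteq> 0} \<subseteq> {i \<in> I. p i \<noteq> 0}" "{k \<in> K. q' k \<noteq> 0} \<subseteq> {k \<in> K. q k \<noteq> 0}"
      using i0 k0 by (auto simp: p'_def q'_def)
    have le: "card {i \<in> I. p' i \<noteq> 0} \<le> card {i \<in> I. p i \<noteq> 0}"
        "card {k \<in> K. q' k \<noteq> 0} \<le> card {k \<in> K. q k \<noteq> 0}"
      using sub assms(1,2) by (auto intro!: card_mono)
    from e(4) have "card {i \<in> I. p' i \<noteq> 0} < card {i \<in> I. p i \<noteq> 0} \<or>
        card {k \<in> K. q' k \<noteq> 0} < card {k \<in> K. q k \<noteq> 0}"
    proof
      assume "e = p i0"
      then have "i0 \<in> {i \<in> I. p i \<noteq> 0} - {i \<in> I. p' i \<noteq> 0}"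
        using i0 by (auto simp: p'_def)
      then show ?thesis
        using sub(1) assms(1) by (intro disjI1 psubset_card_mono) auto
    next
      assume "e = q k0"
      then have "k0 \<in> {k \<in> K. q k \<noteq> 0} - {k \<in> K. q' k \<noteq> 0}"
        using k0 by (auto simp: q'_def)
      then show ?thesis
        using sub(2) assms(2) by (intro disjI2 psubset_card_mono) auto
    qed
    with le have "card {i \<in> I. p' i \<noteq> 0} + card {k \<in> K. q' k \<noteq> 0} <
        card {i \<in> I. p i \<noteq> 0} + card {k \<in> K. q k \<noteq> 0}"
      by linarith
    moreover have "0 \<le> p' i" if "i \<in> I" for i
      using that less.prems(1) e by (auto simp: p'_def)
    moreover have "0 \<le> q' k" if "k \<in> K" for k
      using that less.prems(2) e by (auto simp: q'_def)
    moreover have "sum p' I = sum q' K"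
      using less.prems(3) i0 k0 assms(1,2) by (simp add: p'_def q'_def sum_decrease_at del: fun_upd_apply)
    \<comment> \<open>For \<open>t \<ge> k0\<close> both sides lose \<open>e\<close>, because
      \<open>i0 \<le> k0\<close>. For smaller \<open>t\<close> the left side is zero by the
      minimality of \<open>k0\<close>.\<close>
    moreover have "sum q' {k \<in> K. k \<le> t} \<le> sum p' {i \<in> I. i \<le> t}" for t
    proof (cases "k0 \<le> t")
      case True
      then show ?thesis
        using less.prems(4)[of t] i0 k0 assms(1,2) by (simp add: p'_def q'_def sum_decrease_at del: fun_upd_apply)
    next
      case False
      then have "sum q' {k \<in> K. k \<le> t} = 0"
        using k0_min by (intro sum.neutral) (auto simp: q'_def)
      also have "\<dots> \<le> sum p' {i \<in> I. i \<le> t}"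
        using less.prems(1) e by (intro sum_nonneg) (auto simp: p'_def)
      finally show ?thesis .
    qed
    ultimately have "\<exists>c. (\<forall>i k. 0 \<le> c i k) \<and> (\<forall>i\<in>I. \<forall>k\<in>K. c i k \<noteq> 0 \<longrightarrow> i \<le> k) \<and>
        (\<forall>i\<in>I. (\<Sum>k\<in>K. c i k) = p' i) \<and> (\<forall>k\<in>K. (\<Sum>i\<in>I. c i k) = q' k)"
      by (rule less.hyps[of p' q'])
    then obtain c where c: "\<forall>i k. 0 \<le> c i k" "\<forall>i\<in>I. \<forall>k\<in>K. c i k \<noteq> 0 \<longrightarrow> i \<le> k"
      "\<forall>i\<in>I. (\<Sum>k\<in>K. c i k) = p' i" "\<forall>k\<in>K. (\<Sum>i\<in>I. c i k) = q' k"
      by (elim exE conjE)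
    have "(\<Sum>k\<in>K. c i k + (if i = i0 \<and> k = k0 then e else 0)) = p i" if "i \<in> I" for i
      using that c(3) k0 assms(2) by (cases "i = i0") (auto simp: sum.distrib p'_def)
    moreover have "(\<Sum>i\<in>I. c i k + (if i = i0 \<and> k = k0 then e else 0)) = q k" if "k \<in> K" for k
      using that c(4) i0 assms(1) by (cases "k = k0") (auto simp: sum.distrib q'_def)
    ultimately show ?thesis
      using c(1,2) e(1) i0(2)
      by (intro exI[of _ "\<lambda>i k. c i k + (if i = i0 \<and> k = k0 then e else 0)"]) auto
  qed
qed

section \<open>The graph of a valid pair\<close>

text \<open>In terms of ranks, \<open>Plain i\<close> lies below \<open>Barred j\<close> iff
  \<open>i \<le> j\<close>. The first quantifier excludes plain elements in between, the second one
  barred elements.\<close>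

lemma immediately_precedes_iff:
  "immediately_precedes (support I J) (Plain i) (Barred j) \<longleftrightarrow>
    i \<in> I \<and> j \<in> J \<and> i \<le> j \<and> (\<forall>i'\<in>I. i' \<le> j \<longrightarrow> i' \<le> i) \<and> (\<forall>j'\<in>J. j' < j \<longrightarrow> j' < i)"
  by (auto simp: immediately_precedes_def support_def less_elt_def not_less not_le Suc_le_eq)
    (force simp: not_less)+

text \<open>This removes the definite description: an immediate plain predecessor of
  \<open>Barred j\<close> is the largest element of \<open>I\<close> that is at most
  \<open>j\<close>, hence unique.\<close>

lemma prec_cases:
  obtains (plain) i where "i \<in> I" "immediately_precedes (support I J) (Plain i) (Barred j)"
      "prec I J j = i"
  | (barred) "\<And>i. i \<in> I \<Longrightarrow> \<not> immediately_precedes (support I J) (Plain i) (Barred j)"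
      "prec I J j = j"
proof (cases "\<exists>i\<in>I. immediately_precedes (support I J) (Plain i) (Barred j)")
  case True
  then obtain i where i: "i \<in> I" "immediately_precedes (support I J) (Plain i) (Barred j)"
    by blast
  have "prec I J j = (THE i. i \<in> I \<and> immediately_precedes (support I J) (Plain i) (Barred j))"
    using True by (simp add: prec_def)
  also have "\<dots> = i"
    using i by (intro the_equality) (auto simp: immediately_precedes_iff intro: antisym)
  finally show ?thesis
    using i plain by blast
next
  case False
  then show ?thesis
    using barred by (auto simp: prec_def)
qed

lemma prec_le: "prec I J j \<le> j"
  by (rule prec_cases[of I J j]) (auto simp: immediately_precedes_iff)

text \<open>Either \<open>prec\<close> fixes \<open>j\<close> or it lowers \<open>j\<close> to the
  largest element of \<open>I\<close> below or equal to it, so no element of \<open>I\<close> is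
  passed. This is what allows \<open>J\<close> to be replaced by its image under
  \<open>prec\<close>.\<close>

lemma le_prec_iff: "i \<in> I \<Longrightarrow> i \<le> prec I J j \<longleftrightarrow> i \<le> j"
  by (rule prec_cases[of I J j]) (auto simp: immediately_precedes_iff)

text \<open>Suppose \<open>j < j'\<close> have the same image. It is at most \<open>j\<close>, so
  \<open>prec\<close> does not fix \<open>j'\<close>; but then \<open>Barred j\<close> lies between
  \<open>Barred j'\<close> and its immediate predecessor.\<close>

lemma inj_on_prec: "inj_on (prec I J) J"
proof -
  have False if J: "j \<in> J" "j' \<in> J" and lt: "j < j'" and eq: "prec I J j = prec I J j'" for j j'
  proof (cases rule: prec_cases[of I J j'])
    case (plain i)
    then have "i \<le> j" using prec_le[of I J j] eq by simp
    with plain J lt show False by (auto simp: immediately_precedes_iff)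
  next
    case barred
    then show False using prec_le[of I J j] eq lt by simp
  qed
  then show ?thesis
    by (metis inj_onI linorder_neqE_nat)
qed

section \<open>A fixed valid pair: interpolation, edges and paths of \<open>G\<close>\<close>

locale valid_pair_in =
  fixes n :: nat and I J :: "nat set"
  assumes I_subset: "I \<subseteq> {1..n}" and J_subset: "J \<subseteq> {1..n}" and valid: "valid_pair I J"
begin

abbreviation K :: "nat set" where "K \<equiv> prec I J ` J"
abbreviation E :: "(nat \<times> nat) set" where "E \<equiv> G_edges I J"
abbreviation Eh :: "(aug_vert \<times> aug_vert) set" where "Eh \<equiv> Ghat_edges I J"

lemma finite_I: "finite I" and finite_J: "finite J"
  using I_subset J_subset finite_subset by blast+

lemma finite_K: "finite K"
  using finite_J by simp

lemma K_subset: "K \<subseteq> {1..n}"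
proof
  fix k assume "k \<in> K"
  then obtain j where j: "j \<in> J" "k = prec I J j" by blast
  then show "k \<in> {1..n}"
    using I_subset J_subset by (cases rule: prec_cases[of I J j]) auto
qed

text \<open>Take the first barred element \<open>j0\<close> at or after \<open>i\<close> and the
  last plain element \<open>m\<close> up to \<open>j0\<close>. Nothing lies between them, so
  \<open>prec\<close> sends \<open>j0\<close> to \<open>m\<close>, and \<open>m\<close> is in both
  sets.\<close>

lemma interpolation:
  assumes "i \<in> I" "k \<in> K" "i \<le> k"
  obtains m where "m \<in> I \<inter> K" "i \<le> m" "m \<le> k"
proof -
  obtain j where j: "j \<in> J" "k = prec I J j" using assms(2) by blast
  with assms have ij: "i \<le> j" by (simp add: le_prec_iff)
  define j0 where "j0 = Min {j \<in> J. i \<le> j}"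
  have "j0 \<in> {j \<in> J. i \<le> j}"
    unfolding j0_def using finite_J j ij by (intro Min_in) auto
  moreover have j0_le: "j0 \<le> j'" if "j' \<in> J" "i \<le> j'" for j'
    unfolding j0_def using finite_J that by (intro Min_le) auto
  moreover define m where "m = Max {i \<in> I. i \<le> j0}"
  have "m \<in> {i \<in> I. i \<le> j0}"
    unfolding m_def using finite_I assms calculation by (intro Max_in) auto
  moreover have le_m: "i' \<le> m" if "i' \<in> I" "i' \<le> j0" for i'
    unfolding m_def using finite_I that by (intro Max_ge) auto
  ultimately have ip: "immediately_precedes (support I J) (Plain m) (Barred j0)"
    using assms(1) by (auto simp: immediately_precedes_iff) (metis le_trans not_le)
  have m: "m \<in> I" "i \<le> m" "m \<le> j0" "j0 \<in> J"
    using \<open>m \<in> _\<close> \<open>j0 \<in> _\<close> le_m assms(1) by auto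
  have "prec I J j0 = m"
  proof (cases rule: prec_cases[of I J j0])
    case (plain i)
    then show ?thesis using ip by (auto simp: immediately_precedes_iff intro: antisym)
  next
    case barred
    then show ?thesis using ip m by blast
  qed
  then have "m \<in> I \<inter> K" using m by blast
  \<comment> \<open>\<open>m \<le> j0 \<le> j\<close> by the choice of \<open>j0\<close>, and since
    \<open>m\<close> is in \<open>I\<close> the bound passes to \<open>prec I J j\<close>.\<close>
  moreover have "m \<le> k"
    using m j ij j0_le[of j] by (simp add: le_prec_iff)
  ultimately show ?thesis using that m by blast
qed

text \<open>Validity enters here: the least element is plain, the greatest is barred, and
  interpolation applies to this pair.\<close>

lemma I_Int_K_nonempty: "I \<inter> K \<noteq> {}"
proof -
  have fin: "finite (support I J)"
    using finite_I finite_J by (simp add: support_def)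
  obtain i where i: "i \<in> I" "Min (support I J) = Plain i"
    using valid by (auto simp: valid_pair_def)
  obtain j where j: "j \<in> J" "Max (support I J) = Barred j"
    using valid by (auto simp: valid_pair_def)
  have "Plain i \<le> Barred j"
    using Min_le[OF fin, of "Barred j"] i j by (auto simp: support_def)
  then have "i \<le> prec I J j"
    using i by (simp add: less_eq_elt_def le_prec_iff)
  then obtain m where "m \<in> I \<inter> K"
    using interpolation[OF i(1) imageI[OF j(1)]] by metis
  then show ?thesis by blast
qed

text \<open>An inner vertex of a path has an incoming and an outgoing edge, hence lies in
  \<open>I \<inter> K\<close>. Conversely, one such element strictly between \<open>i\<close> and
  \<open>k\<close> gives a path with two edges, so exactly these pairs are deleted.\<close>

lemma G_edges_iff:
  "(i, k) \<in> E \<longleftrightarrow> i \<in> I \<and> k \<in> K \<and> i < k \<and> (\<forall>m\<in>I \<inter> K. \<not> (i < m \<and> m < k))"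
proof -
  define H where "H = prec_edges I J"
  have H: "(i, k) \<in> H \<longleftrightarrow> i \<in> I \<and> k \<in> K \<and> i < k" for i k
    by (auto simp: H_def prec_edges_def)
  \<comment> \<open>The path leaves \<open>m\<close> by an edge, which puts \<open>m\<close> into
    \<open>I\<close>, and it increases up to \<open>k\<close>.\<close>
  have path: "m \<in> I \<and> m < k" if "successively (\<lambda>u v. (u, v) \<in> H) (m # ws @ [k])" for m ws k
    using that
  proof (induction ws arbitrary: m)
    case (Cons w ws)
    then have "(m, w) \<in> H" "w < k" by auto
    then show ?case using H[of m w] by simp
  qed (simp add: H)
  have "(\<exists>vs. vs \<noteq> [] \<and> dpath H (i # vs @ [k])) \<longleftrightarrow> (\<exists>m\<in>I \<inter> K. i < m \<and> m < k)"
    if ik: "(i, k) \<in> H"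
  proof
    assume "\<exists>vs. vs \<noteq> [] \<and> dpath H (i # vs @ [k])"
    then obtain m ws where "dpath H (i # (m # ws) @ [k])"
      by (metis neq_Nil_conv)
    then have "(i, m) \<in> H" "successively (\<lambda>u v. (u, v) \<in> H) (m # ws @ [k])"
      by (auto simp: dpath_def)
    then show "\<exists>m\<in>I \<inter> K. i < m \<and> m < k"
      using path H by blast
  next
    assume "\<exists>m\<in>I \<inter> K. i < m \<and> m < k"
    then obtain m where "m \<in> I \<inter> K" "i < m" "m < k" by blast
    then have "dpath H (i # [m] @ [k])"
      using ik H by (auto simp: dpath_def)
    then show "\<exists>vs. vs \<noteq> [] \<and> dpath H (i # vs @ [k])" by blast
  qed
  moreover have "(i, k) \<in> E \<longleftrightarrow> (i, k) \<in> H \<and> \<not> (\<exists>vs. vs \<noteq> [] \<and> dpath H (i # vs @ [k]))"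
    by (simp add: G_edges_def min_edges_def H_def)
  ultimately show ?thesis
    using H[of i k] by metis
qed

lemma finite_E: "finite E"
proof (rule finite_subset)
  show "E \<subseteq> I \<times> K" by (auto simp: G_edges_iff)
  show "finite (I \<times> K)" using finite_I finite_K by simp
qed

text \<open>If \<open>(i, k)\<close> is not an edge, go first to the least element \<open>m\<close>
  of \<open>I \<inter> K\<close> above \<open>i\<close>. By minimality \<open>(i, m)\<close> is an
  edge, and the distance to \<open>k\<close> has decreased.\<close>

lemma dpath_exists:
  assumes "i \<in> I" "k \<in> K" "i \<le> k"
  shows "\<exists>vs. dpath E vs \<and> hd vs = i \<and> last vs = k"
  using assms
proof (induction "k - i" arbitrary: i rule: less_induct)
  case less
  show ?case
  proof (cases "i = k \<or> (i, k) \<in> E")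
    case True
    then show ?thesis
    proof
      assume "i = k"
      then show ?thesis by (intro exI[of _ "[k]"]) (simp add: dpath_def)
    next
      assume "(i, k) \<in> E"
      then show ?thesis by (intro exI[of _ "[i, k]"]) (auto simp: dpath_def G_edges_iff)
    qed
  next
    case False
    define m where "m = Min {m \<in> I \<inter> K. i < m}"
    have "\<exists>m\<in>I \<inter> K. i < m \<and> m < k"
      using False less.prems by (auto simp: G_edges_iff)
    then obtain m' where m': "m' \<in> {m \<in> I \<inter> K. i < m}" "m' < k" by blast
    have fin: "finite {m \<in> I \<inter> K. i < m}" using finite_I by simp
    have m: "m \<in> I" "m \<in> K" "i < m"
      using Min_in[OF fin] m' unfolding m_def by blast+
    have m_le: "m \<le> m''" if "m'' \<in> I \<inter> K" "i < m''" for m''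
      unfolding m_def using fin that by (intro Min_le) auto
    then have "m < k" using m' by (metis (mono_tags, lifting) le_less_trans mem_Collect_eq)
    then have "k - m < k - i" using m(3) by linarith
    then obtain vs where vs: "dpath E vs" "hd vs = m" "last vs = k"
      using less.hyps[OF _ m(1) less.prems(2)] \<open>m < k\<close> by (metis less_imp_le)
    have "\<not> (i < m'' \<and> m'' < m)" if "m'' \<in> I \<inter> K" for m''
      using m_le[OF that] by auto
    then have im: "(i, m) \<in> E"
      using m less.prems(1) unfolding G_edges_iff by blast
    \<comment> \<open>Vertices increase along a path, so \<open>i < m\<close> does not recur and may
      be prepended.\<close>
    have "\<forall>v\<in>set vs. m \<le> v"
      using vs(1,2)
    proof (induction vs arbitrary: m rule: induct_list012)
      case (3 u v vs)
      then have "\<forall>x\<in>set (v # vs). v \<le> x" "u < v" by (auto simp: dpath_def G_edges_iff)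
      with 3 show ?case by auto
    qed auto
    then have "dpath E (i # vs)"
      using vs im m(3) by (cases vs) (auto simp: dpath_def)
    then show ?thesis
      using vs by (intro exI[of _ "i # vs"]) (auto simp: dpath_def)
  qed
qed

lemma finite_dpaths: "finite {vs. dpath E vs \<and> hd vs \<in> I \<and> last vs \<in> K}"
proof (rule finite_subset)
  show "{vs. dpath E vs \<and> hd vs \<in> I \<and> last vs \<in> K} \<subseteq> {vs. set vs \<subseteq> I \<union> K \<and> distinct vs}"
  proof
    fix vs assume "vs \<in> {vs. dpath E vs \<and> hd vs \<in> I \<and> last vs \<in> K}"
    then have vs: "dpath E vs" "hd vs \<in> I" by simp_all
    have "set vs \<subseteq> I \<union> K \<and> distinct vs"
      using vs
    proof (induction vs rule: induct_list012)
      case (3 u v vs)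
      have uv: "u \<in> I" "v \<in> K" using 3 by (auto simp: dpath_def G_edges_iff)
      \<comment> \<open>The induction hypothesis needs its head in \<open>I\<close>;
        \<open>v\<close> has an outgoing edge unless the path ends there.\<close>
      have "set (v # vs) \<subseteq> I \<union> K"
      proof (cases vs)
        case (Cons w ws)
        then have "v \<in> I" using 3 by (auto simp: dpath_def G_edges_iff)
        with 3 show ?thesis by (auto simp: dpath_def)
      qed (use uv in auto)
      with uv 3 show ?case by (auto simp: dpath_def)
    qed (auto simp: dpath_def)
    then show "vs \<in> {vs. set vs \<subseteq> I \<union> K \<and> distinct vs}" by simp
  qed
  show "finite {vs. set vs \<subseteq> I \<union> K \<and> distinct vs}"
    using finite_I finite_K by (intro finite_subset_distinct) auto
qed

lemma dpath_hd_le_last: "dpath E vs \<Longrightarrow> hd vs \<le> last vs"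
proof (induction vs rule: induct_list012)
  case (3 u v vs)
  then have "v \<le> last (v # vs)" "u < v" by (auto simp: dpath_def G_edges_iff)
  then show ?case by simp
qed (auto simp: dpath_def)

text \<open>\<open>G\<close> is a forest: an edge ending outside \<open>I\<close> is the only edge at its end, and at most one edge
  out of each vertex ends in \<open>I\<close>. So, going up, the edge values are obtained from the net flows by
  additions and subtractions. With the subgroup \<open>{0}\<close> this says that the net flow map is injective,
  with \<open>\<int>\<close> that it reflects integrality.\<close>

lemma edge_values_in_subgroup:
  fixes A :: "real set"
  assumes A: "0 \<in> A" "\<And>a b. a \<in> A \<Longrightarrow> b \<in> A \<Longrightarrow> a + b \<in> A" "\<And>a. a \<in> A \<Longrightarrow> - a \<in> A"
    and net: "\<And>v. v \<in> I \<union> K \<Longrightarrow> netflow E c v \<in> A"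
    and "(i, k) \<in> E"
  shows "Poly_Mapping.lookup c (i, k) \<in> A"
  using assms(5)
proof (induction i arbitrary: k rule: less_induct)
  case (less i)
  have sum_A: "sum (Poly_Mapping.lookup c) X \<in> A"
    if "finite X" "\<And>e. e \<in> X \<Longrightarrow> Poly_Mapping.lookup c e \<in> A" for X
    using that by (induction X rule: finite_induct) (auto intro: A)
  have leaf: "Poly_Mapping.lookup c (i', k) \<in> A" if "(i', k) \<in> E" "k \<notin> I" for i' k
  proof -
    \<comment> \<open>The element of \<open>I \<inter> K\<close> between \<open>a\<close> and
      \<open>k\<close> given by interpolation is neither \<open>k\<close>, which is outside
      \<open>I\<close>, nor strictly between; so it is \<open>a\<close>.\<close>
    have start: "a \<in> I \<inter> K" if "(a, k) \<in> E" for a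
    proof -
      have a: "a \<in> I" "k \<in> K" "a < k" "\<forall>m\<in>I \<inter> K. \<not> (a < m \<and> m < k)"
        using that by (simp_all add: G_edges_iff)
      then obtain m where m: "m \<in> I \<inter> K" "a \<le> m" "m \<le> k"
        using interpolation[of a k] by (metis less_imp_le)
      moreover have "m \<noteq> k" using m \<open>k \<notin> I\<close> by blast
      ultimately have "m = a" using a(4) by (metis le_neq_implies_less)
      with m show ?thesis by simp
    qed
    \<comment> \<open>Of two different start points in \<open>I \<inter> K\<close>, the larger would
      lie strictly between the smaller one and \<open>k\<close>.\<close>
    have unique: "i'' = i'" if "(i'', k) \<in> E" for i''
      using start[OF that] start[OF \<open>(i', k) \<in> E\<close>] that \<open>(i', k) \<in> E\<close> unfolding G_edges_iff
      by (meson linorder_neqE_nat)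
    have "{e \<in> E. snd e = k} = {(i', k)}"
      using that(1) by (auto dest: unique)
    moreover have "{e \<in> E. fst e = k} = {}"
      using that(2) by (auto simp: G_edges_iff)
    ultimately have "netflow E c k = - Poly_Mapping.lookup c (i', k)"
      by (simp only: netflow_def) simp
    moreover have "k \<in> I \<union> K" using that by (auto simp: G_edges_iff)
    ultimately show ?thesis using net A(3) by (metis minus_minus)
  qed
  show ?case
  proof (cases "k \<in> I")
    case False
    with less.prems leaf show ?thesis by blast
  next
    case True
    have ik: "i \<in> I" "k \<in> I \<inter> K" "i < k" using less.prems True by (auto simp: G_edges_iff)
    let ?out = "{e \<in> E. fst e = i} - {(i, k)}" and ?in = "{e \<in> E. snd e = i}"
    have "Poly_Mapping.lookup c e \<in> A" if "e \<in> ?out" for e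
    proof -
      define k' where "k' = snd e"
      have e: "e \<in> E" "fst e = i" "e \<noteq> (i, k)" using that by blast+
      then have "e = (i, k')" by (simp add: k'_def prod_eq_iff)
      with e have k': "e = (i, k')" "(i, k') \<in> E" "k' \<noteq> k" by simp_all
      \<comment> \<open>Otherwise \<open>k\<close> and \<open>k'\<close> are both in
        \<open>I \<inter> K\<close>, and the smaller lies strictly between \<open>i\<close> and the
        larger.\<close>
      then have "k' \<notin> I"
        using less.prems ik unfolding G_edges_iff by (metis IntI linorder_neqE_nat)
      then show ?thesis using leaf k' by blast
    qed
    then have "sum (Poly_Mapping.lookup c) ?out \<in> A"
      using finite_E by (intro sum_A) auto
    moreover have "sum (Poly_Mapping.lookup c) ?in \<in> A"
    proof (rule sum_A)
      fix e assume "e \<in> ?in"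
      then have "e \<in> E" "snd e = i" by blast+
      then have "(fst e, i) \<in> E" by (metis prod.collapse)
      then have "Poly_Mapping.lookup c (fst e, i) \<in> A"
        using less.IH unfolding G_edges_iff by blast
      then show "Poly_Mapping.lookup c e \<in> A"
        using \<open>snd e = i\<close> by (metis prod.collapse)
    qed (use finite_E in auto)
    moreover have "netflow E c i = Poly_Mapping.lookup c (i, k)
        + sum (Poly_Mapping.lookup c) ?out - sum (Poly_Mapping.lookup c) ?in"
      unfolding netflow_def using finite_E less.prems by (subst sum.remove[of _ "(i, k)"]) auto
    moreover have "netflow E c i \<in> A" using net ik by blast
    ultimately have "netflow E c i + - sum (Poly_Mapping.lookup c) ?out
        + sum (Poly_Mapping.lookup c) ?in \<in> A"
      by (intro A)
    then show ?thesis
      using \<open>netflow E c i = _\<close> by simp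
  qed
qed

section \<open>The four maps\<close>

definition pi1 :: "(aug_vert \<times> aug_vert \<Rightarrow>\<^sub>0 real) \<Rightarrow> (nat \<times> nat \<Rightarrow>\<^sub>0 real)" where
  "pi1 x = (\<Sum>e\<in>E. Poly_Mapping.lookup x (Inner (fst e), Inner (snd e)) *\<^sub>R unit_vec e)"

definition phi1 :: "(aug_vert \<times> aug_vert \<Rightarrow>\<^sub>0 real) \<Rightarrow> (nat \<Rightarrow>\<^sub>0 real) \<times> (nat \<Rightarrow>\<^sub>0 real)" where
  "phi1 x = (\<Sum>i\<in>I. Poly_Mapping.lookup x (Source, Inner i) *\<^sub>R unit_vec i,
             \<Sum>j\<in>J. Poly_Mapping.lookup x (Inner (prec I J j), Sink) *\<^sub>R unit_vec j)"

text \<open>For \<open>j\<close> in \<open>J\<close>, the pair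
  \<open>(unit_vec i, unit_vec j)\<close> goes to the root
  \<open>unit_vec i - unit_vec (prec I J j)\<close>, or to 0 if the two indices agree. On the first
  factor the map is the identity.\<close>

definition pi2 :: "(nat \<Rightarrow>\<^sub>0 real) \<times> (nat \<Rightarrow>\<^sub>0 real) \<Rightarrow> (nat \<Rightarrow>\<^sub>0 real)" where
  "pi2 y = fst y - (\<Sum>j\<in>J. Poly_Mapping.lookup (snd y) j *\<^sub>R unit_vec (prec I J j))"

definition phi2 :: "(nat \<times> nat \<Rightarrow>\<^sub>0 real) \<Rightarrow> (nat \<Rightarrow>\<^sub>0 real)" where
  "phi2 c = (\<Sum>e\<in>E. Poly_Mapping.lookup c e *\<^sub>R (unit_vec (fst e) - unit_vec (snd e)))"

section \<open>Linearity, coordinates and integrality of the four maps\<close>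

lemma linear_pi1: "linear pi1"
  unfolding pi1_def by (rule linear_lookup_sum)

lemma linear_phi2: "linear phi2"
  unfolding phi2_def by (rule linear_lookup_sum[where f = "\<lambda>e. e"])

lemma linear_phi1: "linear phi1"
  by (rule linearI) (simp_all add: phi1_def lookup_add scaleR_add_left sum.distrib scaleR_sum_right)

lemma linear_pi2: "linear pi2"
  by (rule linearI)
    (simp_all add: pi2_def lookup_add scaleR_add_left sum.distrib scaleR_sum_right
      scaleR_diff_right)

lemma lookup_pi1:
  "e \<in> E \<Longrightarrow> Poly_Mapping.lookup (pi1 x) e = Poly_Mapping.lookup x (Inner (fst e), Inner (snd e))"
  unfolding pi1_def using lookup_sum_unit_vec(1)[OF finite_E, of "\<lambda>e. e"] by simp

lemma pi1_in_rspace: "pi1 x \<in> rspace E"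
  unfolding pi1_def rspace_iff using lookup_sum_unit_vec(2)[OF finite_E, of "\<lambda>e. e"] by simp

lemma lookup_phi2: "Poly_Mapping.lookup (phi2 c) v = netflow E c v"
  by (simp add: phi2_def netflow_eq_sum[OF finite_E] lookup_sum lookup_minus lookup_unit_vec)

lemma lookup_fst_phi1:
  "Poly_Mapping.lookup (fst (phi1 x)) i =
    (if i \<in> I then Poly_Mapping.lookup x (Source, Inner i) else 0)"
  unfolding phi1_def using lookup_sum_unit_vec[OF finite_I, of "\<lambda>i. i"] by simp

lemma lookup_snd_phi1:
  "Poly_Mapping.lookup (snd (phi1 x)) j =
    (if j \<in> J then Poly_Mapping.lookup x (Inner (prec I J j), Sink) else 0)"
  unfolding phi1_def using lookup_sum_unit_vec[OF finite_J, of "\<lambda>i. i"] by simp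

lemma netflow_outside: "v \<notin> I \<union> K \<Longrightarrow> netflow E c v = 0"
proof -
  assume "v \<notin> I \<union> K"
  then have "{e \<in> E. fst e = v} = {}" "{e \<in> E. snd e = v} = {}"
    by (auto simp: G_edges_iff)
  then show ?thesis by (simp only: netflow_def sum.empty diff_self)
qed

lemma phi2_in_rspace: "phi2 c \<in> rspace {1..n}"
  using I_subset K_subset by (auto simp: rspace_iff lookup_phi2 intro!: netflow_outside)

lemma phi1_in_rspace: "phi1 x \<in> rspace {1..n} \<times> rspace {1..n}"
  using I_subset J_subset by (auto simp: mem_Times_iff rspace_iff lookup_fst_phi1 lookup_snd_phi1)

lemma pi2_in_rspace:
  assumes "y \<in> rspace {1..n} \<times> rspace {1..n}"
  shows "pi2 y \<in> rspace {1..n}"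
  unfolding pi2_def
proof (intro subspace_diff[OF subspace_rspace] subspace_sum[OF subspace_rspace]
    subspace_scale[OF subspace_rspace])
  show "unit_vec (prec I J j) \<in> rspace {1..n}" if "j \<in> J" for j
    using K_subset that by (intro unit_vec_in_rspace) blast
qed (use assms in auto)

lemma phi1_zspace: "phi1 ` zspace Eh \<subseteq> zspace {1..n} \<times> zspace {1..n}"
proof (rule image_subsetI)
  fix x assume "x \<in> zspace Eh"
  then show "phi1 x \<in> zspace {1..n} \<times> zspace {1..n}"
    using phi1_in_rspace[of x]
    by (simp add: mem_Times_iff zspace_iff lookup_fst_phi1 lookup_snd_phi1)
qed

lemma pi1_zspace: "pi1 ` zspace Eh \<subseteq> zspace E"
proof clarify
  fix x assume "x \<in> zspace Eh"
  then show "pi1 x \<in> zspace E"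
    using pi1_in_rspace by (auto simp: zspace_def lookup_pi1 Ghat_edges_def)
qed

lemma phi2_zspace: "phi2 ` zspace E \<subseteq> zspace {1..n}"
  using phi2_in_rspace
  by (auto simp: zspace_iff lookup_phi2 netflow_def intro!: Ints_diff Ints_sum)

section \<open>Flows on the augmented graph\<close>

lemma Ghat_edges_mem [simp]:
  "(Inner i, Inner k) \<in> Eh \<longleftrightarrow> (i, k) \<in> E"
  "(Source, Inner i) \<in> Eh \<longleftrightarrow> i \<in> I"
  "(Inner k, Sink) \<in> Eh \<longleftrightarrow> k \<in> K"
  "(u, Source) \<notin> Eh" "(Sink, u) \<notin> Eh" "(Source, Sink) \<notin> Eh"
  by (auto simp: Ghat_edges_def)

lemma Ghat_edges_eq:
  "Eh = (\<lambda>e. (Inner (fst e), Inner (snd e))) ` E \<union> (\<lambda>i. (Source, Inner i)) ` I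
    \<union> (\<lambda>k. (Inner k, Sink)) ` K"
  by (force simp: Ghat_edges_def)

lemma finite_Eh: "finite Eh"
  using finite_E finite_I finite_K by (simp add: Ghat_edges_eq)

lemma sum_Ghat_edges:
  fixes g :: "aug_vert \<times> aug_vert \<Rightarrow> real"
  shows "sum g Eh = (\<Sum>e\<in>E. g (Inner (fst e), Inner (snd e))) + (\<Sum>i\<in>I. g (Source, Inner i))
    + (\<Sum>k\<in>K. g (Inner k, Sink))"
proof -
  let ?A = "(\<lambda>e. (Inner (fst e), Inner (snd e))) ` E" and ?B = "(\<lambda>i. (Source, Inner i)) ` I"
    and ?C = "(\<lambda>k. (Inner k, Sink)) ` K"
  have "sum g Eh = sum g ?A + sum g ?B + sum g ?C"
    unfolding Ghat_edges_eq using finite_E finite_I finite_K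
    by (subst sum.union_disjoint; (subst sum.union_disjoint)?) auto
  also have "sum g ?A = (\<Sum>e\<in>E. g (Inner (fst e), Inner (snd e)))"
    by (subst sum.reindex) (auto simp: inj_on_def)
  also have "sum g ?B = (\<Sum>i\<in>I. g (Source, Inner i))"
    by (subst sum.reindex) (auto simp: inj_on_def)
  also have "sum g ?C = (\<Sum>k\<in>K. g (Inner k, Sink))"
    by (subst sum.reindex) (auto simp: inj_on_def)
  finally show ?thesis .
qed

text \<open>The sum over edges splits into inner, source and sink edges. The formula at an inner
  vertex holds for every \<open>v\<close>, because \<open>x\<close> vanishes off the edge
  set.\<close>

lemma netflow_Ghat:
  assumes "x \<in> rspace Eh"
  shows "netflow Eh x Source = (\<Sum>i\<in>I. Poly_Mapping.lookup x (Source, Inner i))"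
    and "netflow Eh x Sink = - (\<Sum>k\<in>K. Poly_Mapping.lookup x (Inner k, Sink))"
    and "netflow Eh x (Inner v) = netflow E (pi1 x) v
      - Poly_Mapping.lookup x (Source, Inner v) + Poly_Mapping.lookup x (Inner v, Sink)"
proof -
  note netflow = netflow_eq_sum[OF finite_Eh] sum_Ghat_edges
  show "netflow Eh x Source = (\<Sum>i\<in>I. Poly_Mapping.lookup x (Source, Inner i))"
    "netflow Eh x Sink = - (\<Sum>k\<in>K. Poly_Mapping.lookup x (Inner k, Sink))"
    by (simp_all add: netflow sum_negf)
  have "(\<Sum>i\<in>I. Poly_Mapping.lookup x (Source, Inner i) * of_bool (i = v)) =
      Poly_Mapping.lookup x (Source, Inner v)"
  proof (cases "v \<in> I")
    case True
    then show ?thesis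
      using sum_of_bool_scaleR[OF finite_I, of v "\<lambda>i. Poly_Mapping.lookup x (Source, Inner i)"]
      by (simp add: mult.commute)
  next
    case False
    then show ?thesis
      using assms by (auto simp: rspace_iff intro!: sum.neutral)
  qed
  moreover have "(\<Sum>k\<in>K. Poly_Mapping.lookup x (Inner k, Sink) * of_bool (k = v)) =
      Poly_Mapping.lookup x (Inner v, Sink)"
  proof (cases "v \<in> K")
    case True
    then show ?thesis
      using sum_of_bool_scaleR[OF finite_K, of v "\<lambda>k. Poly_Mapping.lookup x (Inner k, Sink)"]
      by (simp add: mult.commute)
  next
    case False
    then have "Poly_Mapping.lookup x (Inner v, Sink) = 0"
      using assms by (simp add: rspace_iff)
    moreover have "(\<Sum>k\<in>K. Poly_Mapping.lookup x (Inner k, Sink) * of_bool (k = v)) = 0"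
      using False by (intro sum.neutral) auto
    ultimately show ?thesis by simp
  qed
  moreover have "(\<Sum>e\<in>E. Poly_Mapping.lookup x (Inner (fst e), Inner (snd e)) *
      (of_bool (fst e = v) - of_bool (snd e = v))) = netflow E (pi1 x) v"
    unfolding netflow_eq_sum[OF finite_E] by (intro sum.cong) (auto simp: lookup_pi1)
  ultimately show "netflow Eh x (Inner v) = netflow E (pi1 x) v
      - Poly_Mapping.lookup x (Source, Inner v) + Poly_Mapping.lookup x (Inner v, Sink)"
    by (simp add: netflow sum_negf)
qed

text \<open>Conservation at the inner vertices alone, with no sign condition and no normalisation.
  This is a linear subspace containing the affine hull of the flow polytope, so injectivity and
  integrality are proved on it.\<close>

definition flows :: "(aug_vert \<times> aug_vert \<Rightarrow>\<^sub>0 real) set" where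
  "flows = {x \<in> rspace Eh. \<forall>v\<in>I \<union> K. netflow E (pi1 x) v =
     Poly_Mapping.lookup x (Source, Inner v) - Poly_Mapping.lookup x (Inner v, Sink)}"

lemma F_iff:
  "x \<in> F_Ghat I J \<longleftrightarrow> x \<in> flows \<and> (\<forall>e\<in>Eh. 0 \<le> Poly_Mapping.lookup x e) \<and>
    (\<Sum>i\<in>I. Poly_Mapping.lookup x (Source, Inner i)) = 1 \<and>
    (\<Sum>k\<in>K. Poly_Mapping.lookup x (Inner k, Sink)) = 1"
proof (cases "x \<in> rspace Eh")
  case True
  note net = netflow_Ghat[OF True]
  have "(\<forall>v\<in>Ghat_verts I J. netflow Eh x v = (if v = Source then 1 else if v = Sink then -1 else 0))
      \<longleftrightarrow> netflow Eh x Source = 1 \<and> netflow Eh x Sink = -1 \<and>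
        (\<forall>v\<in>I \<union> K. netflow Eh x (Inner v) = 0)"
    unfolding Ghat_verts_def G_verts_def by auto
  also have "\<dots> \<longleftrightarrow> (\<Sum>i\<in>I. Poly_Mapping.lookup x (Source, Inner i)) = 1 \<and>
      (\<Sum>k\<in>K. Poly_Mapping.lookup x (Inner k, Sink)) = 1 \<and> x \<in> flows"
    unfolding net flows_def using True by (auto simp: algebra_simps)
  finally show ?thesis
    using True unfolding F_Ghat_def flow_polytope_def by blast
next
  case False
  then show ?thesis by (auto simp: F_Ghat_def flow_polytope_def flows_def)
qed

lemma flows_outside: "x \<in> flows \<Longrightarrow> e \<notin> Eh \<Longrightarrow> Poly_Mapping.lookup x e = 0"
  unfolding flows_def rspace_iff by blast

lemma subspace_flows: "subspace flows"
proof (rule subspaceI)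
  \<comment> \<open>Net flow is read as a coordinate of \<open>phi2\<close>, so that the
    conservation condition inherits linearity.\<close>
  note linear = linear_0[OF linear_pi1] linear_add[OF linear_pi1] linear_scale[OF linear_pi1]
    linear_0[OF linear_phi2] linear_add[OF linear_phi2] linear_scale[OF linear_phi2]
  show "0 \<in> flows"
    by (simp add: flows_def subspace_0[OF subspace_rspace] lookup_phi2[symmetric] linear)
  show "x + y \<in> flows" if "x \<in> flows" "y \<in> flows" for x y
    using that
    by (simp add: flows_def subspace_add[OF subspace_rspace] lookup_phi2[symmetric] linear lookup_add)
  show "c *\<^sub>R x \<in> flows" if "x \<in> flows" for x c
    using that
    by (simp add: flows_def subspace_scale[OF subspace_rspace] lookup_phi2[symmetric] linear
        right_diff_distrib)
qed

lemma convex_F: "convex (F_Ghat I J)"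
  unfolding convex_alt
proof clarify
  fix x y :: "aug_vert \<times> aug_vert \<Rightarrow>\<^sub>0 real" and u :: real
  assume x: "x \<in> F_Ghat I J" and y: "y \<in> F_Ghat I J" and u: "0 \<le> u" "u \<le> 1"
  have "(1 - u) *\<^sub>R x + u *\<^sub>R y \<in> flows"
    using x y by (intro subspace_add[OF subspace_flows] subspace_scale[OF subspace_flows])
      (auto simp: F_iff)
  then show "(1 - u) *\<^sub>R x + u *\<^sub>R y \<in> F_Ghat I J"
    using x y u by (simp add: F_iff lookup_add sum.distrib sum_distrib_left[symmetric])
qed

lemma affine_hull_F_subset: "affine hull (F_Ghat I J) \<subseteq> flows"
  by (intro hull_minimal subspace_imp_affine[OF subspace_flows]) (auto simp: F_iff)

text \<open>The source and sink values are coordinates of \<open>phi1 x\<close>. Conservation turns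
  them into the net flow of \<open>pi1 x\<close>, from which the forest structure recovers the inner
  edge values.\<close>

lemma flow_values_in_subgroup:
  fixes A :: "real set"
  assumes A: "0 \<in> A" "\<And>a b. a \<in> A \<Longrightarrow> b \<in> A \<Longrightarrow> a + b \<in> A" "\<And>a. a \<in> A \<Longrightarrow> - a \<in> A"
    and x: "x \<in> flows"
    and p: "\<And>i. Poly_Mapping.lookup (fst (phi1 x)) i \<in> A"
    and q: "\<And>j. Poly_Mapping.lookup (snd (phi1 x)) j \<in> A"
  shows "Poly_Mapping.lookup x e \<in> A"
proof (cases "e \<in> Eh")
  case False
  then show ?thesis using flows_outside[OF x] A(1) by simp
next
  case True
  note x0 = flows_outside[OF x]
  have source: "Poly_Mapping.lookup x (Source, Inner v) \<in> A" for v
    using p[of v] A(1) x0[of "(Source, Inner v)"] by (cases "v \<in> I") (auto simp: lookup_fst_phi1)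
  have sink: "Poly_Mapping.lookup x (Inner v, Sink) \<in> A" for v
  proof (cases "v \<in> K")
    case True
    then obtain j where "j \<in> J" "v = prec I J j" by blast
    then show ?thesis using q[of j] by (simp add: lookup_snd_phi1)
  next
    case False
    then show ?thesis using A(1) x0[of "(Inner v, Sink)"] by simp
  qed
  have net: "netflow E (pi1 x) v \<in> A" if "v \<in> I \<union> K" for v
  proof -
    have "netflow E (pi1 x) v =
        Poly_Mapping.lookup x (Source, Inner v) + - Poly_Mapping.lookup x (Inner v, Sink)"
      using x that by (simp add: flows_def)
    then show ?thesis using A(2)[OF source A(3)[OF sink]] by simp
  qed
  have inner: "Poly_Mapping.lookup x (Inner i, Inner k) \<in> A" if "(i, k) \<in> E" for i k
    using edge_values_in_subgroup[OF A net that] lookup_pi1[OF that] by simp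
  from True show ?thesis
    unfolding Ghat_edges_def using inner source sink by auto
qed

lemma inj_on_phi1: "inj_on phi1 flows"
proof (rule inj_onI)
  fix x y assume xy: "x \<in> flows" "y \<in> flows" "phi1 x = phi1 y"
  have "phi1 (x - y) = 0"
    using xy by (simp add: linear_diff[OF linear_phi1])
  \<comment> \<open>The subgroup is \<open>{0}\<close>: a vanishing image forces the difference to
    vanish.\<close>
  then have "Poly_Mapping.lookup (x - y) e \<in> {0}" for e
    using subspace_diff[OF subspace_flows xy(1,2)]
    by (intro flow_values_in_subgroup) auto
  then show "x = y"
    by (intro poly_mapping_eqI) (simp add: lookup_minus)
qed

lemma inj_on_phi2: "inj_on phi2 (rspace E)"
proof (rule inj_onI)
  fix c d assume cd: "c \<in> rspace E" "d \<in> rspace E" "phi2 c = phi2 d"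
  have "phi2 (c - d) = 0"
    using cd by (simp add: linear_diff[OF linear_phi2])
  then have net: "netflow E (c - d) v \<in> {0}" for v
    by (simp add: lookup_phi2[symmetric])
  have "Poly_Mapping.lookup (c - d) (i, k) \<in> {0}" if "(i, k) \<in> E" for i k
    by (rule edge_values_in_subgroup[OF _ _ _ net that]) auto
  then show "c = d"
    using cd by (intro rspace_eqI[of c E d]) (auto simp: lookup_minus)
qed

text \<open>At each \<open>v\<close> both sides are the source value minus the sink value.
  Injectivity of \<open>prec\<close> ensures that each sink coordinate comes from a single
  \<open>j\<close>.\<close>

lemma pi2_phi1:
  assumes "x \<in> flows"
  shows "pi2 (phi1 x) = phi2 (pi1 x)"
proof (rule poly_mapping_eqI)
  fix v
  note x0 = flows_outside[OF assms]
  have "Poly_Mapping.lookup (\<Sum>j\<in>J. Poly_Mapping.lookup (snd (phi1 x)) j *\<^sub>R unit_vec (prec I J j)) v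
      = Poly_Mapping.lookup x (Inner v, Sink)"
  proof (cases "v \<in> K")
    case True
    then obtain j where "j \<in> J" "v = prec I J j" by blast
    then show ?thesis
      using lookup_sum_unit_vec(1)[OF finite_J inj_on_prec] by (simp add: lookup_snd_phi1)
  next
    case False
    then show ?thesis
      using lookup_sum_unit_vec(2)[OF finite_J inj_on_prec False] x0[of "(Inner v, Sink)"] by simp
  qed
  then have "Poly_Mapping.lookup (pi2 (phi1 x)) v =
      Poly_Mapping.lookup x (Source, Inner v) - Poly_Mapping.lookup x (Inner v, Sink)"
    using x0[of "(Source, Inner v)"] by (simp add: pi2_def lookup_minus lookup_fst_phi1)
  also have "\<dots> = netflow E (pi1 x) v"
  proof (cases "v \<in> I \<union> K")
    case True
    then show ?thesis using assms by (simp add: flows_def)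
  next
    case False
    then show ?thesis
      using x0[of "(Source, Inner v)"] x0[of "(Inner v, Sink)"] by (simp add: netflow_outside)
  qed
  finally show "Poly_Mapping.lookup (pi2 (phi1 x)) v = Poly_Mapping.lookup (phi2 (pi1 x)) v"
    by (simp add: lookup_phi2)
qed

section \<open>Routes\<close>

definition route :: "nat list \<Rightarrow> (aug_vert \<times> aug_vert \<Rightarrow>\<^sub>0 real)" where
  "route vs = indicator_vec (path_edges (Source # map Inner vs @ [Sink]))"

definition route_paths :: "nat list set" where
  "route_paths = {vs. dpath E vs \<and> hd vs \<in> I \<and> last vs \<in> K}"

lemma lookup_route:
  assumes "vs \<in> route_paths"
  shows "Poly_Mapping.lookup (route vs) (Inner i, Inner k) = of_bool ((i, k) \<in> path_edges vs)"
    and "Poly_Mapping.lookup (route vs) (Source, Inner i) = of_bool (i = hd vs)"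
    and "Poly_Mapping.lookup (route vs) (Inner k, Sink) = of_bool (k = last vs)"
proof -
  have "vs \<noteq> []" using assms by (auto simp: route_paths_def dpath_def)
  note edges = path_edges_augmented[OF this]
  show "Poly_Mapping.lookup (route vs) (Inner i, Inner k) = of_bool ((i, k) \<in> path_edges vs)"
    by (force simp: route_def lookup_indicator_vec edges of_bool_def)
  show "Poly_Mapping.lookup (route vs) (Source, Inner i) = of_bool (i = hd vs)"
    "Poly_Mapping.lookup (route vs) (Inner k, Sink) = of_bool (k = last vs)"
    by (auto simp: route_def lookup_indicator_vec edges)
qed

lemma dpath_augmented:
  assumes "vs \<in> route_paths"
  shows "dpath Eh (Source # map Inner vs @ [Sink])"
proof -
  have vs: "vs \<noteq> []" "distinct vs" "successively (\<lambda>u v. (u, v) \<in> E) vs" "hd vs \<in> I" "last vs \<in> K"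
    using assms by (auto simp: route_paths_def dpath_def)
  have "distinct (Source # map Inner vs @ [Sink])"
    using vs(2) by (auto simp: distinct_map inj_on_def)
  moreover have "successively (\<lambda>u v. (u, v) \<in> Eh) (Source # map Inner vs @ [Sink])"
    using vs by (auto simp: successively_Cons successively_append_iff successively_map
        hd_append hd_map last_map)
  ultimately show ?thesis by (simp add: dpath_def)
qed

lemma route_in_F:
  assumes "vs \<in> route_paths"
  shows "route vs \<in> F_Ghat I J"
proof -
  let ?ws = "Source # map Inner vs @ [Sink]"
  have sub: "path_edges ?ws \<subseteq> Eh"
    using dpath_path_edges[OF dpath_augmented[OF assms]] .
  then have "route vs \<in> rspace Eh"
    by (auto simp: route_def rspace_iff lookup_indicator_vec)
  moreover have "netflow Eh (route vs) v = of_bool (v = Source) - of_bool (v = Sink)" for v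
    unfolding route_def using netflow_path[OF finite_Eh dpath_augmented[OF assms]] by simp
  ultimately show ?thesis
    by (auto simp: F_Ghat_def flow_polytope_def route_def lookup_indicator_vec)
qed

lemma route_in_zspace:
  assumes "vs \<in> route_paths"
  shows "route vs \<in> zspace Eh"
  using route_in_F[OF assms]
  by (auto simp: zspace_iff F_Ghat_def flow_polytope_def route_def lookup_indicator_vec of_bool_def)

lemma pi1_route:
  assumes "vs \<in> route_paths"
  shows "pi1 (route vs) = indicator_vec (path_edges vs)"
proof (rule rspace_eqI[OF pi1_in_rspace])
  show "indicator_vec (path_edges vs) \<in> rspace E"
    using assms dpath_path_edges[of E vs]
    by (auto simp: route_paths_def rspace_iff lookup_indicator_vec)
  show "Poly_Mapping.lookup (pi1 (route vs)) e =
      Poly_Mapping.lookup (indicator_vec (path_edges vs)) e" if "e \<in> E" for e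
    by (simp add: lookup_pi1[OF that] lookup_route[OF assms] lookup_indicator_vec)
qed

lemma phi1_route:
  assumes "vs \<in> route_paths" "j \<in> J" "last vs = prec I J j"
  shows "phi1 (route vs) = (unit_vec (hd vs), unit_vec j)"
proof -
  have "hd vs \<in> I" using assms(1) by (simp add: route_paths_def)
  then have "(\<Sum>i\<in>I. of_bool (i = hd vs) *\<^sub>R unit_vec i) = unit_vec (hd vs)"
    using sum_of_bool_scaleR[OF finite_I] by blast
  moreover have "(\<Sum>j'\<in>J. of_bool (prec I J j' = last vs) *\<^sub>R unit_vec j') =
      (\<Sum>j'\<in>J. of_bool (j' = j) *\<^sub>R unit_vec j' :: nat \<Rightarrow>\<^sub>0 real)"
    using assms(2,3) inj_on_prec[of I J] by (intro sum.cong) (auto dest: inj_onD)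
  then have "(\<Sum>j'\<in>J. of_bool (prec I J j' = last vs) *\<^sub>R unit_vec j') = unit_vec j"
    using sum_of_bool_scaleR[OF finite_J assms(2)] by metis
  ultimately show ?thesis
    by (simp add: phi1_def lookup_route[OF assms(1)])
qed

section \<open>Routes and the vertices of \<open>U_poly\<close>; the flow polytope as the hull of
  the routes\<close>

definition U_vertices :: "((nat \<Rightarrow>\<^sub>0 real) \<times> (nat \<Rightarrow>\<^sub>0 real)) set" where
  "U_vertices = {(unit_vec i, unit_vec j) | i j. i \<in> I \<and> j \<in> J \<and> i \<le> prec I J j}"

lemma U_poly_eq: "U_poly I J = convex hull U_vertices"
proof -
  have "Plain i < Barred j \<longleftrightarrow> i \<le> prec I J j" if "i \<in> I" for i j
    using that by (auto simp: less_elt_def le_prec_iff)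
  then show ?thesis
    unfolding U_poly_def U_vertices_def by (intro arg_cong[where f = "\<lambda>S. convex hull S"]) blast
qed

text \<open>A path from \<open>i\<close> to \<open>prec I J j\<close> forces
  \<open>i \<le> prec I J j\<close> because edges increase, and \<open>dpath_exists\<close> supplies
  a path whenever this inequality holds.\<close>

lemma phi1_routes: "phi1 ` route ` route_paths = U_vertices"
proof
  show "phi1 ` route ` route_paths \<subseteq> U_vertices"
    unfolding image_image
  proof (rule image_subsetI)
    fix vs assume vs: "vs \<in> route_paths"
    then obtain j where j: "j \<in> J" "last vs = prec I J j"
      by (auto simp: route_paths_def)
    have "hd vs \<in> I" "hd vs \<le> prec I J j"
      using vs j dpath_hd_le_last[of vs] by (auto simp: route_paths_def)
    then show "phi1 (route vs) \<in> U_vertices"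
      using j phi1_route[OF vs j] by (auto simp: U_vertices_def)
  qed
  show "U_vertices \<subseteq> phi1 ` route ` route_paths"
  proof
    fix y assume "y \<in> U_vertices"
    then obtain i j where ij: "y = (unit_vec i, unit_vec j)" "i \<in> I" "j \<in> J" "i \<le> prec I J j"
      by (auto simp: U_vertices_def)
    then obtain vs where vs: "dpath E vs" "hd vs = i" "last vs = prec I J j"
      using dpath_exists[of i "prec I J j"] by blast
    then have "vs \<in> route_paths" using ij by (simp add: route_paths_def)
    moreover have "y = phi1 (route vs)"
      using phi1_route[OF calculation ij(3) vs(3)] ij vs by simp
    ultimately show "y \<in> phi1 ` route ` route_paths" by blast
  qed
qed

text \<open>Edges go from smaller to larger vertices, so the flow through the cut at \<open>t\<close> is nonnegative.\<close>

lemma flow_dominance: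
  assumes "x \<in> F_Ghat I J"
  shows "(\<Sum>k\<in>{k \<in> K. k \<le> t}. Poly_Mapping.lookup x (Inner k, Sink)) \<le>
    (\<Sum>i\<in>{i \<in> I. i \<le> t}. Poly_Mapping.lookup x (Source, Inner i))"
proof -
  let ?V = "{v \<in> I \<union> K. v \<le> t}"
  have x: "x \<in> flows" "\<And>e. e \<in> Eh \<Longrightarrow> 0 \<le> Poly_Mapping.lookup x e"
    using assms by (auto simp: F_iff)
  have fin: "finite ?V" using finite_I finite_K by simp
  have "0 \<le> (\<Sum>e\<in>E. Poly_Mapping.lookup (pi1 x) e * (of_bool (fst e \<in> ?V) - of_bool (snd e \<in> ?V)))"
  proof (intro sum_nonneg mult_nonneg_nonneg)
    fix e assume e: "e \<in> E"
    then have "(Inner (fst e), Inner (snd e)) \<in> Eh" by simp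
    then show "0 \<le> Poly_Mapping.lookup (pi1 x) e"
      using x(2) lookup_pi1[OF e] by simp
    have "fst e \<in> I" "snd e \<in> K" "fst e < snd e"
      using e G_edges_iff[of "fst e" "snd e"] by simp_all
    then show "0 \<le> (of_bool (fst e \<in> ?V) - of_bool (snd e \<in> ?V) :: real)"
      by (simp add: of_bool_def)
  qed
  also have "\<dots> = (\<Sum>v\<in>?V. netflow E (pi1 x) v)"
    using sum_netflow[OF finite_E fin] by simp
  also have "\<dots> = (\<Sum>v\<in>?V. Poly_Mapping.lookup x (Source, Inner v) - Poly_Mapping.lookup x (Inner v, Sink))"
    using x(1) by (intro sum.cong) (auto simp: flows_def)
  also have "\<dots> = (\<Sum>v\<in>?V. Poly_Mapping.lookup x (Source, Inner v))
      - (\<Sum>v\<in>?V. Poly_Mapping.lookup x (Inner v, Sink))"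
    by (rule sum_subtractf)
  also have "(\<Sum>v\<in>?V. Poly_Mapping.lookup x (Source, Inner v)) =
      (\<Sum>i\<in>{i \<in> I. i \<le> t}. Poly_Mapping.lookup x (Source, Inner i))"
    using fin by (intro sum.mono_neutral_right) (auto intro!: flows_outside[OF x(1)])
  also have "(\<Sum>v\<in>?V. Poly_Mapping.lookup x (Inner v, Sink)) =
      (\<Sum>k\<in>{k \<in> K. k \<le> t}. Poly_Mapping.lookup x (Inner k, Sink))"
    using fin by (intro sum.mono_neutral_right ballI flows_outside[OF x(1)]) auto
  finally show ?thesis by simp
qed

text \<open>The coupling of source and sink values provides the coefficients of a convex combination
  of vertices. Its two marginals are the two components of \<open>phi1 x\<close>.\<close>

lemma phi1_F_subset: "phi1 ` F_Ghat I J \<subseteq> U_poly I J"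
proof (rule image_subsetI)
  fix x assume xF: "x \<in> F_Ghat I J"
  let ?p = "\<lambda>i. Poly_Mapping.lookup x (Source, Inner i)"
    and ?q = "\<lambda>k. Poly_Mapping.lookup x (Inner k, Sink)"
  have "0 \<le> ?p i" if "i \<in> I" for i using xF that by (simp add: F_iff)
  moreover have "0 \<le> ?q k" if "k \<in> K" for k using xF that by (simp add: F_iff)
  moreover have "sum ?p I = sum ?q K" using xF by (simp add: F_iff)
  ultimately obtain c where c: "\<forall>i k. 0 \<le> c i k" "\<forall>i\<in>I. \<forall>k\<in>K. c i k \<noteq> 0 \<longrightarrow> i \<le> k"
      "\<forall>i\<in>I. (\<Sum>k\<in>K. c i k) = ?p i" "\<forall>k\<in>K. (\<Sum>i\<in>I. c i k) = ?q k"
    using coupling_of_dominance[OF finite_I finite_K _ _ _ flow_dominance[OF xF]] by metis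
  define d where "d = (\<lambda>(i, j). c i (prec I J j))"
  define S where "S = {(i, j) \<in> I \<times> J. i \<le> prec I J j}"
  define y where "y = (\<lambda>(i, j). (unit_vec i :: nat \<Rightarrow>\<^sub>0 real, unit_vec j :: nat \<Rightarrow>\<^sub>0 real))"
  have fin: "finite (I \<times> J)" using finite_I finite_J by simp
  \<comment> \<open>The coupling charges only pairs with \<open>i \<le> prec I J j\<close>, those
    giving vertices, so sums over \<open>S\<close> extend to the whole product, where marginals can
    be taken.\<close>
  have S: "S \<subseteq> I \<times> J" "\<forall>z\<in>I \<times> J - S. d z = 0"
    using c(2) by (auto simp: S_def d_def)
  have row: "(\<Sum>j\<in>J. c i (prec I J j)) = ?p i" if "i \<in> I" for i
    using c(3) that sum.reindex[OF inj_on_prec[of I J], of "c i"] by simp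
  have "sum d S = sum d (I \<times> J)"
    using S fin by (intro sum.mono_neutral_left) auto
  also have "\<dots> = (\<Sum>i\<in>I. \<Sum>j\<in>J. c i (prec I J j))"
    by (simp add: sum.cartesian_product d_def)
  also have "\<dots> = 1"
    using row xF by (simp add: F_iff)
  finally have "(\<Sum>z\<in>S. d z *\<^sub>R y z) \<in> convex hull U_vertices"
    using S(1) fin c(1)
    by (intro convex_sum hull_inc)
      (auto simp: d_def y_def S_def U_vertices_def intro: finite_subset)
  moreover have "(\<Sum>z\<in>S. d z *\<^sub>R y z) = (\<Sum>z\<in>I \<times> J. d z *\<^sub>R y z)"
    using S fin by (intro sum.mono_neutral_left) auto
  moreover have "\<dots> = phi1 x"
  proof (rule prod_eqI)
    have "fst (\<Sum>z\<in>I \<times> J. d z *\<^sub>R y z) = (\<Sum>(i, j)\<in>I \<times> J. c i (prec I J j) *\<^sub>R unit_vec i)"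
      by (simp add: fst_sum d_def y_def case_prod_unfold)
    also have "\<dots> = (\<Sum>i\<in>I. (\<Sum>j\<in>J. c i (prec I J j)) *\<^sub>R unit_vec i)"
      by (simp add: sum.cartesian_product[symmetric] scaleR_sum_left)
    also have "\<dots> = fst (phi1 x)"
      by (simp add: phi1_def row)
    finally show "fst (\<Sum>z\<in>I \<times> J. d z *\<^sub>R y z) = fst (phi1 x)" .
    have "snd (\<Sum>z\<in>I \<times> J. d z *\<^sub>R y z) = (\<Sum>(i, j)\<in>I \<times> J. c i (prec I J j) *\<^sub>R unit_vec j)"
      by (simp add: snd_sum d_def y_def case_prod_unfold)
    also have "\<dots> = (\<Sum>j\<in>J. \<Sum>i\<in>I. c i (prec I J j) *\<^sub>R unit_vec j)"
      by (subst sum.swap) (simp add: sum.cartesian_product)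
    also have "\<dots> = snd (phi1 x)"
      using c(4) by (simp add: phi1_def scaleR_sum_left[symmetric])
    finally show "snd (\<Sum>z\<in>I \<times> J. d z *\<^sub>R y z) = snd (phi1 x)" .
  qed
  ultimately show "phi1 x \<in> U_poly I J"
    by (simp add: U_poly_eq)
qed

lemma phi1_hull_routes: "phi1 ` (convex hull (route ` route_paths)) = U_poly I J"
  by (simp add: convex_hull_linear_image[OF linear_phi1] phi1_routes U_poly_eq)

text \<open>The image of a flow under \<open>phi1\<close> is also the image of a point in the hull
  of the routes. Both points lie in \<open>flows\<close>, where \<open>phi1\<close> is injective, so
  they coincide.\<close>

lemma F_eq_hull_routes: "F_Ghat I J = convex hull (route ` route_paths)"
proof
  show sub: "convex hull (route ` route_paths) \<subseteq> F_Ghat I J"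
    by (intro hull_minimal convex_F) (auto intro: route_in_F)
  show "F_Ghat I J \<subseteq> convex hull (route ` route_paths)"
  proof
    fix x assume x: "x \<in> F_Ghat I J"
    then obtain y where y: "y \<in> convex hull (route ` route_paths)" "phi1 x = phi1 y"
      using phi1_F_subset phi1_hull_routes by blast
    then have "x = y"
      using x sub by (intro inj_onD[OF inj_on_phi1]) (auto simp: F_iff)
    with y show "x \<in> convex hull (route ` route_paths)" by simp
  qed
qed

lemma phi1_F: "phi1 ` F_Ghat I J = U_poly I J"
  by (simp add: F_eq_hull_routes phi1_hull_routes)

lemma pi1_F: "pi1 ` F_Ghat I J = S_G I J"
proof -
  let ?D = "{indicator_vec (path_edges vs) | vs. dpath E vs \<and> hd vs \<in> I \<and> last vs \<in> K}"
  have "pi1 ` route ` route_paths = (\<lambda>vs. indicator_vec (path_edges vs)) ` route_paths"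
    unfolding image_image by (intro image_cong) (simp_all add: pi1_route)
  also have "\<dots> = ?D" unfolding route_paths_def by blast
  finally have "pi1 ` F_Ghat I J = convex hull ?D"
    by (simp add: F_eq_hull_routes convex_hull_linear_image[OF linear_pi1])
  \<comment> \<open>The one-vertex path at \<open>m\<close> has no edges, so its indicator vector is
    0 and the extra 0 in the path polytope is already present.\<close>
  moreover obtain m where "m \<in> I \<inter> K" using I_Int_K_nonempty by blast
  then have "indicator_vec (path_edges [m]) \<in> ?D"
    by (intro CollectI exI[of _ "[m]"]) (simp add: dpath_def)
  then have "insert 0 ?D = ?D"
    by (intro insert_absorb) (simp add: indicator_vec_def)
  ultimately show ?thesis
    by (simp add: S_G_def path_polytope_def)
qed

lemma lattice_F: "lattice_polytope (zspace Eh) (F_Ghat I J)"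
  unfolding lattice_polytope_def F_eq_hull_routes
  using finite_dpaths route_in_zspace
  by (intro exI[of _ "route ` route_paths"]) (auto simp: route_paths_def)

section \<open>The root polytope\<close>

text \<open>The nonnegative vectors on the edges form a convex cone whose image under
  \<open>phi2\<close> is again one. It contains the generators, hence the whole hull.\<close>

lemma cone_G_edges:
  assumes "x \<in> convex_cone hull {unit_vec i - unit_vec j | i j. (i, j) \<in> E}"
  obtains c where "c \<in> rspace E" "\<forall>e. 0 \<le> Poly_Mapping.lookup c e" "x = phi2 c"
proof -
  let ?C = "{c \<in> rspace E. \<forall>e. 0 \<le> Poly_Mapping.lookup c e}"
  have "convex_cone ?C"
    by (auto simp: convex_cone_iff lookup_add subspace_0[OF subspace_rspace]
        subspace_add[OF subspace_rspace] subspace_scale[OF subspace_rspace])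
  then have "convex_cone (phi2 ` ?C)"
    using linear_phi2 by (intro convex_cone_linear_image) simp
  moreover have "{unit_vec i - unit_vec j | i j. (i, j) \<in> E} \<subseteq> phi2 ` ?C"
  proof clarify
    fix i j assume ij: "(i, j) \<in> E"
    have "phi2 (unit_vec (i, j)) = (\<Sum>e\<in>E. of_bool (e = (i, j)) *\<^sub>R (unit_vec (fst e) - unit_vec (snd e)))"
      by (auto simp: phi2_def lookup_unit_vec intro!: sum.cong)
    also have "\<dots> = unit_vec i - unit_vec j"
      using sum_of_bool_scaleR[OF finite_E ij, of "\<lambda>e. unit_vec (fst e) - unit_vec (snd e)"]
      by (simp only: fst_conv snd_conv)
    finally show "unit_vec i - unit_vec j \<in> phi2 ` ?C"
      using ij unit_vec_in_rspace[OF ij] by (intro image_eqI[of _ _ "unit_vec (i, j)"])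
        (auto simp: lookup_unit_vec)
  qed
  ultimately have "convex_cone hull {unit_vec i - unit_vec j | i j. (i, j) \<in> E} \<subseteq> phi2 ` ?C"
    by (intro hull_minimal)
  then show ?thesis using assms that by blast
qed

text \<open>The total positive part is a convex function with value at most 1 at 0 and at every
  root, so its sublevel set contains the hull.\<close>

lemma positive_part_le_1:
  assumes "x \<in> convex hull (insert 0 {unit_vec i - unit_vec j | i j. 1 \<le> i \<and> i < j \<and> j \<le> n})"
  shows "(\<Sum>v\<in>{1..n}. max 0 (Poly_Mapping.lookup x v)) \<le> 1"
proof -
  let ?f = "\<lambda>x :: nat \<Rightarrow>\<^sub>0 real. \<Sum>v\<in>{1..n}. max 0 (Poly_Mapping.lookup x v)"
  have "convex {x. ?f x \<le> 1}"
    unfolding convex_alt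
  proof (intro ballI allI impI)
    fix x y and u :: real
    assume "x \<in> {x. ?f x \<le> 1}" "y \<in> {x. ?f x \<le> 1}" "0 \<le> u \<and> u \<le> 1"
    then have xy: "?f x \<le> 1" "?f y \<le> 1" and u: "0 \<le> u" "u \<le> 1"
      by simp_all
    have "?f ((1 - u) *\<^sub>R x + u *\<^sub>R y) \<le> (\<Sum>v\<in>{1..n}.
        (1 - u) * max 0 (Poly_Mapping.lookup x v) + u * max 0 (Poly_Mapping.lookup y v))"
    proof (rule sum_mono)
      fix v
      have "(1 - u) * Poly_Mapping.lookup x v \<le> (1 - u) * max 0 (Poly_Mapping.lookup x v)"
        "u * Poly_Mapping.lookup y v \<le> u * max 0 (Poly_Mapping.lookup y v)"
        "0 \<le> (1 - u) * max 0 (Poly_Mapping.lookup x v)"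
        "0 \<le> u * max 0 (Poly_Mapping.lookup y v)"
        using u by (auto intro!: mult_left_mono mult_nonneg_nonneg)
      then show "max 0 (Poly_Mapping.lookup ((1 - u) *\<^sub>R x + u *\<^sub>R y) v) \<le>
          (1 - u) * max 0 (Poly_Mapping.lookup x v) + u * max 0 (Poly_Mapping.lookup y v)"
        by (simp add: lookup_add)
    qed
    also have "\<dots> = (1 - u) * ?f x + u * ?f y"
      by (simp add: sum.distrib sum_distrib_left)
    also have "\<dots> \<le> (1 - u) * 1 + u * 1"
      using xy u by (intro add_mono mult_left_mono) auto
    finally show "(1 - u) *\<^sub>R x + u *\<^sub>R y \<in> {x. ?f x \<le> 1}" by simp
  qed
  moreover have "?f (unit_vec i - unit_vec j) \<le> 1" if "i < j" for i j
  proof -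
    have "?f (unit_vec i - unit_vec j) \<le> (\<Sum>v\<in>{1..n}. of_bool (i = v))"
      by (intro sum_mono) (auto simp: lookup_minus lookup_unit_vec)
    also have "\<dots> \<le> 1" by (simp add: of_bool_def)
    finally show ?thesis .
  qed
  ultimately have "convex hull (insert 0 {unit_vec i - unit_vec j | i j. 1 \<le> i \<and> i < j \<and> j \<le> n})
      \<subseteq> {x. ?f x \<le> 1}"
    by (intro hull_minimal) auto
  with assms show ?thesis by blast
qed

text \<open>A flow \<open>c\<close> on \<open>G\<close> with net flow \<open>x\<close> extends to the augmented graph by sending the
  positive part of \<open>x\<close>
  in from the source and the negative part out to the sink. The missing mass is routed through a
  vertex of \<open>I \<inter> K\<close>, where it does not change the net flow.\<close>

lemma P_G_subset: "P_G n I J \<subseteq> phi2 ` pi1 ` F_Ghat I J"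
proof
  fix x assume "x \<in> P_G n I J"
  then have x: "x \<in> convex hull (insert 0 {unit_vec i - unit_vec j | i j. 1 \<le> i \<and> i < j \<and> j \<le> n})"
    "x \<in> convex_cone hull {unit_vec i - unit_vec j | i j. (i, j) \<in> E}"
    by (auto simp: P_G_def root_polytope_def)
  obtain c where c: "c \<in> rspace E" "\<forall>e. 0 \<le> Poly_Mapping.lookup c e" "x = phi2 c"
    using cone_G_edges[OF x(2)] by blast
  obtain m where m: "m \<in> I" "m \<in> K" using I_Int_K_nonempty by blast
  define f where "f v = netflow E c v" for v
  define \<delta> where "\<delta> = 1 - (\<Sum>i\<in>I. max 0 (f i))"
  have fin: "finite (I \<union> K)" using finite_I finite_K by simp
  \<comment> \<open>Without outgoing edges the net flow cannot be positive, so its positive part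
    lives on \<open>I\<close>; dually, its negative part lives on \<open>K\<close>.\<close>
  have "f v \<le> 0" if "v \<notin> I" for v
  proof -
    have "{e \<in> E. fst e = v} = {}" using that by (auto simp: G_edges_iff)
    then have "f v = - (\<Sum>e\<in>{e \<in> E. snd e = v}. Poly_Mapping.lookup c e)"
      by (simp only: f_def netflow_def sum.empty diff_0)
    moreover have "0 \<le> (\<Sum>e\<in>{e \<in> E. snd e = v}. Poly_Mapping.lookup c e)"
      using c(2) by (intro sum_nonneg) blast
    ultimately show ?thesis by simp
  qed
  then have pos: "(\<Sum>i\<in>I. max 0 (f i)) = (\<Sum>v\<in>I \<union> K. max 0 (f v))"
    using fin by (intro sum_max_zero) auto
  have "- f v \<le> 0" if "v \<notin> K" for v
  proof -
    have "{e \<in> E. snd e = v} = {}" using that by (auto simp: G_edges_iff)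
    then have "f v = (\<Sum>e\<in>{e \<in> E. fst e = v}. Poly_Mapping.lookup c e)"
      by (simp only: f_def netflow_def sum.empty diff_0_right)
    moreover have "0 \<le> (\<Sum>e\<in>{e \<in> E. fst e = v}. Poly_Mapping.lookup c e)"
      using c(2) by (intro sum_nonneg) blast
    ultimately show ?thesis by simp
  qed
  then have neg: "(\<Sum>k\<in>K. max 0 (- f k)) = (\<Sum>v\<in>I \<union> K. max 0 (- f v))"
    using fin by (intro sum_max_zero) auto
  \<comment> \<open>Net flows cancel in total, so both parts have the same mass and the same
    \<open>\<delta>\<close> completes each of them to 1.\<close>
  have "(\<Sum>v\<in>I \<union> K. max 0 (f v)) - (\<Sum>v\<in>I \<union> K. max 0 (- f v)) = (\<Sum>v\<in>I \<union> K. f v)"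
    by (simp add: sum_subtractf[symmetric] max_def) (intro sum.cong, auto)
  also have "\<dots> = 0"
    unfolding f_def sum_netflow[OF finite_E fin]
  proof (intro sum.neutral ballI)
    fix e assume "e \<in> E"
    then have "fst e \<in> I \<union> K" "snd e \<in> I \<union> K"
      using G_edges_iff[of "fst e" "snd e"] by simp_all
    then show "Poly_Mapping.lookup c e * (of_bool (fst e \<in> I \<union> K) - of_bool (snd e \<in> I \<union> K)) = 0"
      by simp
  qed
  finally have sums: "(\<Sum>k\<in>K. max 0 (- f k)) = (\<Sum>i\<in>I. max 0 (f i))"
    using pos neg by simp
  \<comment> \<open>Membership in the hull of the roots is used here; it makes
    \<open>\<delta>\<close> nonnegative.\<close>
  have "(\<Sum>v\<in>I \<union> K. max 0 (f v)) \<le> (\<Sum>v\<in>{1..n}. max 0 (f v))"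
    using I_subset K_subset by (intro sum_mono2) auto
  also have "\<dots> \<le> 1"
    using positive_part_le_1[OF x(1)] by (simp add: c(3) lookup_phi2 f_def)
  finally have \<delta>: "0 \<le> \<delta>"
    using pos by (simp add: \<delta>_def)
  define g where "g = (\<lambda>(u, v). case (u, v) of
      (Inner i, Inner k) \<Rightarrow> Poly_Mapping.lookup c (i, k)
    | (Source, Inner i) \<Rightarrow> max 0 (f i) + (if i = m then \<delta> else 0)
    | (Inner k, Sink) \<Rightarrow> max 0 (- f k) + (if k = m then \<delta> else 0)
    | _ \<Rightarrow> 0)"
  obtain X where X: "X \<in> rspace Eh" "\<And>e. e \<in> Eh \<Longrightarrow> Poly_Mapping.lookup X e = g e"
    using rspace_prescribed[OF finite_Eh, of g] by blast
  have pi1_X: "pi1 X = c"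
    using c(1) X(2) by (intro rspace_eqI[OF pi1_in_rspace]) (auto simp: lookup_pi1 g_def)
  have source: "Poly_Mapping.lookup X (Source, Inner i) = max 0 (f i) + (if i = m then \<delta> else 0)"
    if "i \<in> I" for i
    using X(2)[of "(Source, Inner i)"] that by (simp add: g_def)
  have sink: "Poly_Mapping.lookup X (Inner k, Sink) = max 0 (- f k) + (if k = m then \<delta> else 0)"
    if "k \<in> K" for k
    using X(2)[of "(Inner k, Sink)"] that by (simp add: g_def)
  have "f v = Poly_Mapping.lookup X (Source, Inner v) - Poly_Mapping.lookup X (Inner v, Sink)"
    if "v \<in> I \<union> K" for v
  proof -
    have "Poly_Mapping.lookup X (Source, Inner v) = max 0 (f v) + (if v = m then \<delta> else 0)"
    proof (cases "v \<in> I")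
      case False
      then have "Poly_Mapping.lookup X (Source, Inner v) = 0" "v \<noteq> m"
        using X(1) m by (auto simp: rspace_iff)
      then show ?thesis using \<open>\<And>v. v \<notin> I \<Longrightarrow> f v \<le> 0\<close>[OF False] by simp
    qed (rule source)
    moreover have "Poly_Mapping.lookup X (Inner v, Sink) = max 0 (- f v) + (if v = m then \<delta> else 0)"
    proof (cases "v \<in> K")
      case False
      then have "Poly_Mapping.lookup X (Inner v, Sink) = 0"
        using X(1) by (simp add: rspace_iff)
      moreover have "v \<noteq> m" using m False by blast
      ultimately show ?thesis using \<open>\<And>v. v \<notin> K \<Longrightarrow> - f v \<le> 0\<close>[OF False] by simp
    qed (rule sink)
    ultimately show ?thesis by (simp add: max_def)
  qed
  then have "X \<in> flows"
    using X(1) by (simp add: flows_def pi1_X f_def)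
  moreover have "0 \<le> Poly_Mapping.lookup X e" if "e \<in> Eh" for e
    using X(2)[OF that] c(2) \<delta> by (auto simp: g_def split: prod.split aug_vert.split)
  moreover have "(\<Sum>i\<in>I. Poly_Mapping.lookup X (Source, Inner i)) = 1"
    using m finite_I by (simp add: source sum.distrib \<delta>_def)
  moreover have "(\<Sum>k\<in>K. Poly_Mapping.lookup X (Inner k, Sink)) = 1"
  proof -
    have "(\<Sum>k\<in>K. Poly_Mapping.lookup X (Inner k, Sink)) =
        (\<Sum>k\<in>K. max 0 (- f k) + (if k = m then \<delta> else 0))"
      by (intro sum.cong sink refl)
    also have "\<dots> = (\<Sum>k\<in>K. max 0 (- f k)) + \<delta>"
      unfolding sum.distrib using m(2) finite_K by (subst sum.delta) (simp_all only: if_True)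
    finally show ?thesis by (simp only: sums \<delta>_def)
  qed
  ultimately have "X \<in> F_Ghat I J" by (simp add: F_iff)
  then show "x \<in> phi2 ` pi1 ` F_Ghat I J"
    using pi1_X c(3) by blast
qed

lemma pi2_U_eq: "pi2 ` U_poly I J = phi2 ` pi1 ` F_Ghat I J"
  unfolding phi1_F[symmetric] image_image by (intro image_cong) (auto simp: pi2_phi1 F_iff)

text \<open>The two constraints come from different descriptions of the same set: the hull of the
  roots is checked on the vertices of \<open>U_poly\<close>, the cone on flows through the commuting
  square, where the edge values are nonnegative coefficients.\<close>

lemma pi2_U_subset: "pi2 ` U_poly I J \<subseteq> P_G n I J"
proof -
  have "pi2 ` U_vertices \<subseteq>
      convex hull (insert 0 {unit_vec i - unit_vec j | i j. 1 \<le> i \<and> i < j \<and> j \<le> n})"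
  proof
    fix z assume "z \<in> pi2 ` U_vertices"
    then obtain i j where ij: "i \<in> I" "j \<in> J" "i \<le> prec I J j" and z: "z = pi2 (unit_vec i, unit_vec j)"
      by (auto simp: U_vertices_def)
    have "(\<Sum>j'\<in>J. of_bool (j = j') *\<^sub>R unit_vec (prec I J j') :: nat \<Rightarrow>\<^sub>0 real) = unit_vec (prec I J j)"
      using sum_of_bool_scaleR[OF finite_J ij(2)] by (simp add: eq_commute)
    then have z_eq: "z = unit_vec i - unit_vec (prec I J j)"
      by (simp add: z pi2_def lookup_unit_vec)
    have "1 \<le> i" "prec I J j \<le> n"
      using I_subset K_subset ij by auto
    then have "z \<in> insert 0 {unit_vec i - unit_vec j | i j. 1 \<le> i \<and> i < j \<and> j \<le> n}"
    proof (cases "i = prec I J j")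
      case False
      then have "i < prec I J j" using ij(3) by simp
      with z_eq \<open>1 \<le> i\<close> \<open>prec I J j \<le> n\<close> show ?thesis by blast
    qed (simp add: z_eq)
    then show "z \<in> convex hull (insert 0 {unit_vec i - unit_vec j | i j. 1 \<le> i \<and> i < j \<and> j \<le> n})"
      by (rule hull_inc)
  qed
  then have "pi2 ` U_poly I J \<subseteq>
      convex hull (insert 0 {unit_vec i - unit_vec j | i j. 1 \<le> i \<and> i < j \<and> j \<le> n})"
    unfolding U_poly_eq convex_hull_linear_image[OF linear_pi2]
    by (intro hull_minimal convex_convex_hull)
  moreover have "pi2 ` U_poly I J \<subseteq> convex_cone hull {unit_vec i - unit_vec j | i j. (i, j) \<in> E}"
    unfolding pi2_U_eq
  proof clarify
    fix x assume x: "x \<in> F_Ghat I J"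
    let ?C = "convex_cone hull {unit_vec i - unit_vec j | i j. (i, j) \<in> E}"
    have sum_C: "sum h S \<in> ?C" if "finite S" "\<And>e. e \<in> S \<Longrightarrow> h e \<in> ?C"
      for h :: "nat \<times> nat \<Rightarrow> nat \<Rightarrow>\<^sub>0 real" and S
      using that by (induction S rule: finite_induct)
        (auto intro: convex_cone_hull_add convex_cone_hull_contains_0)
    show "phi2 (pi1 x) \<in> ?C"
      unfolding phi2_def
    proof (intro sum_C finite_E convex_cone_hull_mul)
      fix e assume e: "e \<in> E"
      then show "unit_vec (fst e) - unit_vec (snd e) \<in> ?C"
        by (intro hull_inc CollectI exI[of _ "fst e"] exI[of _ "snd e"]) simp
      show "0 \<le> Poly_Mapping.lookup (pi1 x) e"
        using x e by (simp add: lookup_pi1 F_iff)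
    qed
  qed
  ultimately show ?thesis
    by (simp add: P_G_def root_polytope_def)
qed

section \<open>Images in the root polytope and the two integral equivalences\<close>

lemma pi2_U: "pi2 ` U_poly I J = P_G n I J"
  using pi2_U_subset P_G_subset by (auto simp: pi2_U_eq)

lemma phi2_S: "phi2 ` S_G I J = P_G n I J"
  by (simp add: pi1_F[symmetric] pi2_U_eq[symmetric] pi2_U)

lemma integral_equivalence_phi1:
  "integral_equivalence (zspace Eh) (F_Ghat I J) (zspace {1..n} \<times> zspace {1..n}) (U_poly I J) phi1"
  unfolding phi1_F[symmetric]
proof (rule integral_equivalence_linearI[OF linear_phi1 lattice_F _ _ phi1_zspace])
  show "lattice_polytope (zspace {1..n} \<times> zspace {1..n}) (phi1 ` F_Ghat I J)"
    by (rule lattice_polytope_linear_image[OF linear_phi1 phi1_zspace lattice_F])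
  show "inj_on phi1 (affine hull F_Ghat I J)"
    using inj_on_subset[OF inj_on_phi1 affine_hull_F_subset] .
  fix x assume "x \<in> affine hull F_Ghat I J" "phi1 x \<in> zspace {1..n} \<times> zspace {1..n}"
  then have x: "x \<in> flows" "fst (phi1 x) \<in> zspace {1..n}" "snd (phi1 x) \<in> zspace {1..n}"
    using affine_hull_F_subset by (auto simp: mem_Times_iff)
  \<comment> \<open>The subgroup is now \<open>\<int>\<close>: integral source and sink values force
    integral edge values.\<close>
  have "Poly_Mapping.lookup x e \<in> \<int>" for e
    by (rule flow_values_in_subgroup[OF _ _ _ x(1)]) (use x in \<open>auto simp: zspace_iff\<close>)
  then show "x \<in> zspace Eh"
    using x(1) by (simp add: zspace_iff flows_def)
qed

lemma integral_equivalence_phi2: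
  "integral_equivalence (zspace E) (S_G I J) (zspace {1..n}) (P_G n I J) phi2"
  unfolding phi2_S[symmetric]
proof (rule integral_equivalence_linearI[OF linear_phi2 _ _ _ phi2_zspace])
  show lattice_S: "lattice_polytope (zspace E) (S_G I J)"
    unfolding pi1_F[symmetric]
    by (rule lattice_polytope_linear_image[OF linear_pi1 pi1_zspace lattice_F])
  show "lattice_polytope (zspace {1..n}) (phi2 ` S_G I J)"
    by (rule lattice_polytope_linear_image[OF linear_phi2 phi2_zspace lattice_S])
  have sub: "affine hull S_G I J \<subseteq> rspace E"
    by (intro hull_minimal subspace_imp_affine[OF subspace_rspace])
      (auto simp: pi1_F[symmetric] pi1_in_rspace)
  then show "inj_on phi2 (affine hull S_G I J)"
    using inj_on_phi2 inj_on_subset by blast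
  fix c assume c: "c \<in> affine hull S_G I J" "phi2 c \<in> zspace {1..n}"
  then have net: "netflow E c v \<in> \<int>" for v
    by (simp add: zspace_iff lookup_phi2)
  have "Poly_Mapping.lookup c (i, k) \<in> \<int>" if "(i, k) \<in> E" for i k
    by (rule edge_values_in_subgroup[OF _ _ _ net that]) auto
  then show "c \<in> zspace E"
    using c(1) sub by (auto simp: zspace_def)
qed

end

theorem theorem3p1:
  fixes n :: nat and I J :: "nat set"
  assumes "n \<ge> 1" and "I \<subseteq> {1..n}" and "J \<subseteq> {1..n}" and "valid_pair I J"
  shows "\<exists>(\<pi>\<^sub>1 :: (aug_vert \<times> aug_vert \<Rightarrow>\<^sub>0 real) \<Rightarrow> (nat \<times> nat \<Rightarrow>\<^sub>0 real))
          (\<phi>\<^sub>1 :: (aug_vert \<times> aug_vert \<Rightarrow>\<^sub>0 real) \<Rightarrow> (nat \<Rightarrow>\<^sub>0 real) \<times> (nat \<Rightarrow>\<^sub>0 real))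
          (\<pi>\<^sub>2 :: (nat \<Rightarrow>\<^sub>0 real) \<times> (nat \<Rightarrow>\<^sub>0 real) \<Rightarrow> (nat \<Rightarrow>\<^sub>0 real))
          (\<phi>\<^sub>2 :: (nat \<times> nat \<Rightarrow>\<^sub>0 real) \<Rightarrow> (nat \<Rightarrow>\<^sub>0 real)).
      linear_map_on (rspace (Ghat_edges I J)) (rspace (G_edges I J)) \<pi>\<^sub>1 \<and>
      linear_map_on (rspace (Ghat_edges I J)) (rspace {1..n} \<times> rspace {1..n}) \<phi>\<^sub>1 \<and>
      linear_map_on (rspace {1..n} \<times> rspace {1..n}) (rspace {1..n}) \<pi>\<^sub>2 \<and>
      linear_map_on (rspace (G_edges I J)) (rspace {1..n}) \<phi>\<^sub>2 \<and>
      (\<forall>x \<in> rspace (Ghat_edges I J). \<forall>(i, j) \<in> G_edges I J.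
         Poly_Mapping.lookup (\<pi>\<^sub>1 x) (i, j) = Poly_Mapping.lookup x (Inner i, Inner j)) \<and>
      \<pi>\<^sub>1 ` F_Ghat I J = S_G I J \<and>
      \<pi>\<^sub>2 ` (rspace {1..n} \<times> rspace {1..n}) = rspace {1..n} \<and>
      \<pi>\<^sub>2 ` U_poly I J = P_G n I J \<and>
      integral_equivalence (zspace (Ghat_edges I J)) (F_Ghat I J)
        (zspace {1..n} \<times> zspace {1..n}) (U_poly I J) \<phi>\<^sub>1 \<and>
      integral_equivalence (zspace (G_edges I J)) (S_G I J)
        (zspace {1..n}) (P_G n I J) \<phi>\<^sub>2 \<and>
      (\<forall>x \<in> F_Ghat I J. \<pi>\<^sub>2 (\<phi>\<^sub>1 x) = \<phi>\<^sub>2 (\<pi>\<^sub>1 x))"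
proof -
  interpret valid_pair_in n I J
    using assms by unfold_locales
  \<comment> \<open>Being the identity on the first factor makes \<open>pi2\<close> surjective, as
    required of a projection.\<close>
  have "pi2 (y, 0) = y" for y
    by (simp add: pi2_def)
  then have surj: "pi2 ` (rspace {1..n} \<times> rspace {1..n}) = rspace {1..n}"
    using pi2_in_rspace subspace_0[OF subspace_rspace, of "{1..n}"]
    by (force intro: rev_image_eqI)
  show ?thesis
  proof (intro exI conjI)
    show "linear_map_on (rspace Eh) (rspace E) pi1"
      by (auto simp: linear_map_on_def linear_pi1 pi1_in_rspace)
    show "linear_map_on (rspace Eh) (rspace {1..n} \<times> rspace {1..n}) phi1"
      using phi1_in_rspace by (auto simp: linear_map_on_def linear_phi1 image_subset_iff)
    show "linear_map_on (rspace {1..n} \<times> rspace {1..n}) (rspace {1..n}) pi2"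
      using surj by (simp add: linear_map_on_def linear_pi2)
    show "linear_map_on (rspace E) (rspace {1..n}) phi2"
      using phi2_in_rspace by (auto simp: linear_map_on_def linear_phi2)
    show "\<forall>x \<in> rspace Eh. \<forall>(i, j) \<in> E.
        Poly_Mapping.lookup (pi1 x) (i, j) = Poly_Mapping.lookup x (Inner i, Inner j)"
      using lookup_pi1 by auto
    show "\<forall>x \<in> F_Ghat I J. pi2 (phi1 x) = phi2 (pi1 x)"
      using pi2_phi1 by (auto simp: F_iff)
  qed (fact pi1_F surj pi2_U integral_equivalence_phi1 integral_equivalence_phi2)+
qed

end
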